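(* Let $X$ be a reflexive real Banach space; let $I:X\to\mathbf{R}$ be a sequentially weakly lower semicontinuous and coercive $C^1$ functional whose derivative $I':X\to X^*$ admits a continuous inverse on $X^*$; let $J,\Psi,\Phi:X\to\mathbf{R}$ be three $C^1$ functionals with compact derivative satisfying the following conditions: $$\liminf_{\|x\|\to+\infty}\frac{J(x)}{I(x)}\geq 0,\qquad \limsup_{\|x\|\to+\infty}\frac{J(x)}{I(x)}<+\infty,$$ $$\liminf_{\|x\|\to+\infty}\frac{\Psi(x)}{I(x)}=-\infty,$$ $$\inf_{x\in X}(\Psi(x)+\lambda\Phi(x))>-\infty\quad\text{for all }\lambda>0.$$ Moreover, assume that there exist a strict local minimum $x_0$ of $I$, with $I(x_0)=J(x_0)=\Psi(x_0)=\Phi(x_0)=0$, and another point $x_1\in X$ such that $$\max\{J(x_1),\Psi(x_1),\Phi(x_1)\}<0,$$ $$\min\left\{\liminf_{x\to x_0}\frac{J(x)}{I(x)},\ \liminf_{x\to x_0}\frac{\Phi(x)}{I(x)}\right\}\geq 0$$ and $$\liminf_{x\to x_0}\frac{\Psi(x)}{I(x)}>-\infty.$$ Then, for each $\nu,\mu$ satisfying $$\nu>\max\left\{0,-\frac{I(x_1)}{J(x_1)}\right\}$$ and $$\mu>\max\left\{0,\ -\liminf_{x\to x_0}\frac{\Psi(x)}{I(x)},\ \inf_{r>\sup_{M_\nu}\Phi}\mu^*(I+\nu J,\Psi,\Phi,r)\right\},$$ where $M_\nu$ is the set of all global minima (i.e. global minimum points) of $I+\nu J$ in $X$, there exists $\lambda^*>0$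 such that the functional $\mu(I+\nu J)+\Psi+\lambda^*\Phi$ has at least four critical points. Precisely, among them, one is $x_0$, which is a strict local, not global, minimum of this functional, and two are global minima of this functional.
   Context: Definition of $\mu^*$. Let $X$ be a non-empty set and $\Gamma,\Psi,\Phi:X\to\mathbf{R}$ three functions such that $\Psi+\Phi$ is bounded below. For each $r\in\,]\inf_X\Phi,\sup_X\Phi[$ such that $$\inf_{x\in\Phi^{-1}(]-\infty,r])}\Gamma(x)<\inf_{x\in\Phi^{-1}(r)}\Gamma(x),$$ one puts $$\mu^*(\Gamma,\Psi,\Phi,r)=\inf\left\{\frac{\Psi(x)-\gamma+r}{\eta_r-\Gamma(x)}\ :\ x\in X,\ \Phi(x)<r,\ \Gamma(x)<\eta_r\right\},$$ where $$\gamma=\inf_{x\in X}(\Psi(x)+\Phi(x)),\qquad \eta_r=\inf_{x\in\Phi^{-1}(r)}\Gamma(x).$$ In the claim this is used with $\Gamma=I+\nu J$. Conventions. $X^*$ is the topological dual of $X$ with its norm. "Coercive" means $I(x)\to+\infty$ as $\|x\|\to+\infty$. "$C^1$" means continuously Fréchet differentiable. A $C^1$ functional has compact derivative if its derivative, as a map from $X$ to $X^*$, maps bounded sets to relatively compact sets. "Admits a continuous inverse on $X^*$" means that $I':X\to X^*$ is a bijection with continuous inverse. A critical point is a point at which the derivative vanishes. The limits $x\to x_0$ are in the norm topology with $x\neq x_0$, and local minima are understood with respect to the norm topology. *)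

theory Defs
  imports "HOL-Analysis.Analysis"
begin

text \<open>The topological dual of \<open>'a\<close> with its operator norm is the type \<open>'a \<Rightarrow>\<^sub>L real\<close>.\<close>

definition bidual_embedding :: "'a::real_normed_vector \<Rightarrow> (('a \<Rightarrow>\<^sub>L real) \<Rightarrow>\<^sub>L real)" where
  "bidual_embedding x = Blinfun (\<lambda>f. blinfun_apply f x)"

lemma bidual_embedding_apply [simp]:
  "blinfun_apply (bidual_embedding x) f = blinfun_apply f x"
  unfolding bidual_embedding_def
  by (simp add: bounded_linear_Blinfun_apply blinfun.bounded_linear_left)

definition reflexive_space :: "'a::real_normed_vector itself \<Rightarrow> bool" where
  "reflexive_space _ \<longleftrightarrow> surj (bidual_embedding :: 'a \<Rightarrow> _)"

definition weakly_converges :: "(nat \<Rightarrow> 'a::real_normed_vector) \<Rightarrow> 'a \<Rightarrow> bool" where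
  "weakly_converges u x \<longleftrightarrow>
     (\<forall>f :: 'a \<Rightarrow>\<^sub>L real. (\<lambda>n. blinfun_apply f (u n)) \<longlonglongrightarrow> blinfun_apply f x)"

definition seq_weakly_lsc :: "('a::real_normed_vector \<Rightarrow> real) \<Rightarrow> bool" where
  "seq_weakly_lsc f \<longleftrightarrow>
     (\<forall>u x. weakly_converges u x \<longrightarrow> ereal (f x) \<le> liminf (\<lambda>n. ereal (f (u n))))"

definition coercive :: "('a::real_normed_vector \<Rightarrow> real) \<Rightarrow> bool" where
  "coercive f \<longleftrightarrow> filterlim f at_top at_infinity"

text \<open>The Frechet derivative as an element of the dual; only meaningful where \<open>f\<close> is
  differentiable.\<close>

definition fderiv :: "('a::real_normed_vector \<Rightarrow> real) \<Rightarrow> 'a \<Rightarrow> ('a \<Rightarrow>\<^sub>L real)" where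
  "fderiv f x = Blinfun (frechet_derivative f (at x))"

lemma has_derivative_fderiv:
  assumes "f differentiable (at x)"
  shows "(f has_derivative blinfun_apply (fderiv f x)) (at x)"
proof -
  have "(f has_derivative frechet_derivative f (at x)) (at x)"
    using assms frechet_derivative_works by blast
  then show ?thesis
    unfolding fderiv_def
    by (simp add: bounded_linear_Blinfun_apply has_derivative_bounded_linear)
qed

definition C1 :: "('a::real_normed_vector \<Rightarrow> real) \<Rightarrow> bool" where
  "C1 f \<longleftrightarrow> (\<forall>x. f differentiable (at x)) \<and> continuous_on UNIV (fderiv f)"

definition compact_derivative :: "('a::real_normed_vector \<Rightarrow> real) \<Rightarrow> bool" where
  "compact_derivative f \<longleftrightarrow> (\<forall>B. bounded B \<longrightarrow> compact (closure (fderiv f ` B)))"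

definition derivative_has_continuous_inverse :: "('a::real_normed_vector \<Rightarrow> real) \<Rightarrow> bool" where
  "derivative_has_continuous_inverse f \<longleftrightarrow>
     bij (fderiv f) \<and> continuous_on UNIV (inv (fderiv f))"

definition critical_point :: "('a::real_normed_vector \<Rightarrow> real) \<Rightarrow> 'a \<Rightarrow> bool" where
  "critical_point f x \<longleftrightarrow> (f has_derivative (\<lambda>_. 0)) (at x)"

definition strict_local_min :: "('a::real_normed_vector \<Rightarrow> real) \<Rightarrow> 'a \<Rightarrow> bool" where
  "strict_local_min f x \<longleftrightarrow> (\<forall>\<^sub>F y in at x. f x < f y)"

definition global_min :: "('a \<Rightarrow> real) \<Rightarrow> 'a \<Rightarrow> bool" where
  "global_min f x \<longleftrightarrow> (\<forall>y. f x \<le> f y)"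

definition eta :: "('a \<Rightarrow> real) \<Rightarrow> ('a \<Rightarrow> real) \<Rightarrow> real \<Rightarrow> ereal" where
  "eta \<Gamma> \<Phi> r = (INF x\<in>{x. \<Phi> x = r}. ereal (\<Gamma> x))"

text \<open>All infima and suprema are taken in the extended reals, so that no junk values arise for
  empty or unbounded index sets. The values of \<open>r\<close> for which \<open>\<mu>\<^sup>*\<close> is defined are singled out by
  \<open>mu_star_defined\<close>; outside of them \<open>mu_star\<close> has no meaning.\<close>

definition mu_star_defined :: "('a \<Rightarrow> real) \<Rightarrow> ('a \<Rightarrow> real) \<Rightarrow> real \<Rightarrow> bool" where
  "mu_star_defined \<Gamma> \<Phi> r \<longleftrightarrow>
     (INF x. ereal (\<Phi> x)) < ereal r \<and> ereal r < (SUP x. ereal (\<Phi> x)) \<and>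
     (INF x\<in>{x. \<Phi> x \<le> r}. ereal (\<Gamma> x)) < eta \<Gamma> \<Phi> r"

definition mu_star ::
    "('a \<Rightarrow> real) \<Rightarrow> ('a \<Rightarrow> real) \<Rightarrow> ('a \<Rightarrow> real) \<Rightarrow> real \<Rightarrow> ereal" where
  "mu_star \<Gamma> \<Psi> \<Phi> r =
     (INF x\<in>{x. \<Phi> x < r \<and> ereal (\<Gamma> x) < eta \<Gamma> \<Phi> r}.
        (ereal (\<Psi> x) - (INF y. ereal (\<Psi> y + \<Phi> y)) + ereal r) / (eta \<Gamma> \<Phi> r - ereal (\<Gamma> x)))"

end

theory Submission
  imports Defs
begin

text \<open>Put \<open>\<Gamma> = I + \<nu> J\<close>, \<open>P = \<mu> \<Gamma> + \<Psi>\<close> and, for \<open>l > 0\<close>, \<open>F\<^sub>l = P + l \<Phi>\<close>. The number \<open>\<lambda>\<^sup>*\<close> is a Lagrange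
  multiplier at which \<open>F\<^sub>l\<close> has minimizers on both sides of a level set of \<open>\<Phi>\<close>.

  Two global minima. Since \<open>\<mu>\<close> exceeds \<open>\<mu>\<^sup>*(\<Gamma>, \<Psi>, \<Phi>, r)\<close> for some \<open>r\<close>, there is a point \<open>z\<close> with \<open>\<Phi> z < r\<close>
  at which \<open>P\<close> is smaller than at every point of the level set \<open>\<Phi> = r\<close>
  (\<open>mu_star_strict_separation\<close>). The growth conditions make \<open>P\<close> unbounded below, while every \<open>F\<^sub>l\<close>
  attains its infimum. So the minimizers of \<open>F\<^sub>l\<close> satisfy \<open>\<Phi> \<ge> r\<close> for small \<open>l\<close> and \<open>\<Phi> \<le> r\<close> for large
  \<open>l\<close>, and by connectedness some \<open>l\<close> admits minimizers \<open>u\<close> and \<open>v\<close> with \<open>\<Phi> u \<le> r \<le> \<Phi> v\<close>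
  (\<open>two_minimizers_at_common_multiplier\<close>). No minimizer lies on the level set \<open>\<Phi> = r\<close>, because
  \<open>F\<^sub>l\<close> is smaller at \<open>z\<close>; hence \<open>u \<noteq> v\<close>.

  The other two critical points. Near \<open>x0\<close> the functional \<open>F\<^sub>l\<close> is at least a positive multiple of
  \<open>I\<close>, so \<open>x0\<close> is a strict local minimum, with value \<open>0\<close> (\<open>strict_local_min_combination\<close>). It is
  not a global one, because all terms are negative at \<open>x1\<close>. The mountain pass theorem
  (\<open>mountain_pass\<close>) between \<open>x0\<close> and \<open>u\<close> gives a critical point with a positive value, which is
  therefore none of \<open>x0\<close>, \<open>u\<close>, \<open>v\<close>.

  Compactness. The source is the Palais--Smale condition: \<open>F\<^sub>l\<close> is \<open>\<mu> I\<close> plus a functional with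
  compact derivative, and \<open>I'\<close> has a continuous inverse
  (\<open>palais_smale_compact_perturbation\<close>). Together with Ekeland's variational principle it gives
  the minimizers of \<open>F\<^sub>l\<close>, a gap between the value at a strict local minimum and the values on small
  spheres around it, and, with Ekeland's principle on a space of paths, the mountain pass theorem.
  The lower bound for \<open>I\<close> comes from the same source: a second point with
  \<open>I \<le> I x0\<close> would force a second zero of the injective map \<open>I'\<close>, so \<open>x0\<close> is the global minimum
  of \<open>I\<close> (\<open>strict_local_min_imp_strict_global_min\<close>).\<close>

section \<open>Continuously differentiable functionals\<close>

lemma fderiv_eq:
  assumes "(f has_derivative blinfun_apply A) (at x)"
  shows "fderiv f x = A"
proof -
  have "frechet_derivative f (at x) = blinfun_apply A"
    using assms frechet_derivative_at by metis
  then show ?thesis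
    unfolding fderiv_def by (simp add: blinfun_apply_inverse)
qed

lemma C1_has_derivative:
  assumes "C1 f"
  shows "(f has_derivative blinfun_apply (fderiv f x)) (at x within S)"
  using assms has_derivative_fderiv has_derivative_at_withinI unfolding C1_def by blast

lemma C1_continuous_on: "C1 f \<Longrightarrow> continuous_on S f"
  by (meson C1_has_derivative has_derivative_continuous_on)

lemma C1_tendsto:
  assumes "C1 f" "u \<longlonglongrightarrow> l"
  shows "(\<lambda>n. f (u n)) \<longlonglongrightarrow> f l"
  by (rule continuous_on_tendsto_compose[of UNIV f]) (auto intro: C1_continuous_on assms)

lemma C1_fderiv_tendsto:
  assumes "C1 f" "u \<longlonglongrightarrow> l"
  shows "(\<lambda>n. fderiv f (u n)) \<longlonglongrightarrow> fderiv f l"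
  by (rule continuous_on_tendsto_compose[of UNIV "fderiv f"]) (use assms in \<open>auto simp: C1_def\<close>)

lemma fderiv_add:
  assumes "C1 f" "C1 g"
  shows "fderiv (\<lambda>x. f x + g x) x = fderiv f x + fderiv g x"
  by (rule fderiv_eq)
    (auto intro!: derivative_eq_intros C1_has_derivative assms simp: blinfun.add_left)

lemma fderiv_cmult:
  fixes c :: real
  assumes "C1 f"
  shows "fderiv (\<lambda>x. c * f x) x = c *\<^sub>R fderiv f x"
  by (rule fderiv_eq)
    (auto intro!: derivative_eq_intros C1_has_derivative assms simp: blinfun.scaleR_left)

lemma C1_add:
  assumes "C1 f" "C1 g"
  shows "C1 (\<lambda>x. f x + g x)"
  using assms fderiv_add[OF assms] unfolding C1_def
  by (auto intro!: differentiable_add continuous_intros)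

lemma C1_cmult:
  fixes c :: real
  assumes "C1 f"
  shows "C1 (\<lambda>x. c * f x)"
  using assms fderiv_cmult[OF assms] unfolding C1_def
  by (auto intro!: differentiable_mult continuous_intros)

lemma critical_point_iff_fderiv:
  assumes "C1 f"
  shows "critical_point f x \<longleftrightarrow> fderiv f x = 0"
proof
  assume "critical_point f x"
  then have "(f has_derivative blinfun_apply 0) (at x)"
    unfolding critical_point_def by (simp add: zero_blinfun.rep_eq)
  then show "fderiv f x = 0" by (rule fderiv_eq)
next
  assume "fderiv f x = 0"
  then show "critical_point f x"
    using C1_has_derivative[OF assms, of x UNIV]
    unfolding critical_point_def by (simp add: zero_blinfun.rep_eq)
qed

lemma local_min_critical:
  assumes "C1 f" "\<forall>\<^sub>F y in at x. f x \<le> f y"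
  shows "critical_point f x"
  using has_derivative_local_min[OF C1_has_derivative[OF assms(1)] assms(2)]
    C1_has_derivative[OF assms(1), of x UNIV]
  unfolding critical_point_def by simp

lemma global_min_critical:
  assumes "C1 f" "global_min f x"
  shows "critical_point f x"
  using assms unfolding global_min_def by (intro local_min_critical) auto

lemma C1_mean_value:
  assumes "C1 f" and "0 < s"
  obtains \<theta> where "0 < \<theta>" "\<theta> < s"
    "f (y + s *\<^sub>R v) - f y = s * blinfun_apply (fderiv f (y + \<theta> *\<^sub>R v)) v"
proof -
  have D: "((\<lambda>\<tau>. f (y + \<tau> *\<^sub>R v)) has_real_derivative
      blinfun_apply (fderiv f (y + \<tau> *\<^sub>R v)) v) (at \<tau>)" for \<tau>
  proof -
    have "((\<lambda>\<tau>. f (y + \<tau> *\<^sub>R v)) has_derivative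
      (\<lambda>h. blinfun_apply (fderiv f (y + \<tau> *\<^sub>R v)) (h *\<^sub>R v))) (at \<tau>)"
      by (rule has_derivative_compose[OF _ C1_has_derivative[OF assms(1)]])
        (auto intro!: derivative_eq_intros)
    then show ?thesis
      by (simp add: has_field_derivative_def blinfun.scaleR_right mult.commute[of _ "blinfun_apply _ _"])
  qed
  obtain \<theta> where "0 < \<theta>" "\<theta> < s"
    "f (y + s *\<^sub>R v) - f (y + 0 *\<^sub>R v) = (s - 0) * blinfun_apply (fderiv f (y + \<theta> *\<^sub>R v)) v"
    using MVT2[OF assms(2), of "\<lambda>\<tau>. f (y + \<tau> *\<^sub>R v)"
        "\<lambda>\<tau>. blinfun_apply (fderiv f (y + \<tau> *\<^sub>R v)) v"] D by blast
  then show thesis using that by auto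
qed

lemma blinfun_norm_gt_witness:
  fixes A :: "'a::real_normed_vector \<Rightarrow>\<^sub>L real"
  assumes "0 \<le> e" "e < norm A"
  obtains v where "norm v \<le> 1" "e < blinfun_apply A v"
proof -
  have "\<exists>v. norm v \<le> 1 \<and> e < blinfun_apply A v"
  proof (rule ccontr)
    assume "\<not> ?thesis"
    then have small: "norm v \<le> 1 \<Longrightarrow> blinfun_apply A v \<le> e" for v by force
    have half: "blinfun_apply A v \<le> e * norm v" for v
    proof (cases "v = 0")
      case False
      have "blinfun_apply A (inverse (norm v) *\<^sub>R v) \<le> e"
        by (rule small) (simp add: False)
      then show ?thesis using False by (simp add: blinfun.scaleR_right field_simps)
    qed simp
    have "norm A \<le> e"
    proof (rule norm_blinfun_bound[OF assms(1)])
      show "norm (blinfun_apply A v) \<le> e * norm v" for v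
        using half[of v] half[of "- v"] by (simp add: blinfun.minus_right abs_le_iff)
    qed
    with assms(2) show False by simp
  qed
  with that show thesis by blast
qed

section \<open>Ekeland's variational principle\<close>

text \<open>Call \<open>y\<close> reachable from \<open>x\<close> if the value drops by at least \<open>e\<close> times the distance. Reachability
  is transitive, so a sequence of reachable points whose values are almost as small as possible at
  each step is Cauchy: the total drop bounds its length. Everything reachable from the limit is
  reachable from all members of the sequence, so it cannot have a smaller value than the limit.\<close>

lemma ekeland:
  fixes f :: "'a::metric_space \<Rightarrow> real"
  assumes S: "complete S" and x: "x \<in> S" and e: "0 < e"
    and lower: "\<And>y. y \<in> S \<Longrightarrow> c \<le> f y"
    and lsc: "\<And>a. closed {y \<in> S. f y \<le> a}"
  obtains y where "y \<in> S" "f y + e * dist x y \<le> f x"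
    "\<And>z. z \<in> S \<Longrightarrow> f y \<le> f z + e * dist y z"
proof -
  define T where "T x = {y \<in> S. f y + e * dist x y \<le> f x}" for x
  have T_refl: "x \<in> T x" if "x \<in> S" for x
    using that unfolding T_def by simp
  have T_trans: "z \<in> T x" if "y \<in> T x" "z \<in> T y" for x y z
  proof -
    have "e * dist x z \<le> e * dist x y + e * dist y z"
      using e dist_triangle[of x z y] by (simp flip: distrib_left)
    then show ?thesis using that unfolding T_def by auto
  qed
  have T_S: "y \<in> S" if "y \<in> T x" for x y using that unfolding T_def by simp
  have step: "\<exists>w. w \<in> S \<and> w \<in> T v \<and> (\<forall>z\<in>T v. f w \<le> f z + (1/2) ^ n)" if v: "v \<in> S" for v n
  proof -
    have bdd: "bdd_below (f ` T v)" using lower T_S by (intro bdd_belowI[of _ c]) auto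
    have "\<exists>w\<in>f ` T v. w < Inf (f ` T v) + (1/2) ^ n"
      using cInf_lessD[of "f ` T v" "Inf (f ` T v) + (1/2) ^ n"] T_refl[OF v] by auto
    then obtain w where w: "w \<in> T v" "f w < Inf (f ` T v) + (1/2) ^ n" by blast
    have "f w \<le> f z + (1/2) ^ n" if "z \<in> T v" for z
      using cInf_lower[OF imageI[OF that] bdd] w(2) by simp
    with w(1) T_S show ?thesis by blast
  qed
  obtain u where u0: "u 0 = x" and uS: "\<And>n. u n \<in> S" and uT: "\<And>n. u (Suc n) \<in> T (u n)"
    and u_min: "\<And>n z. z \<in> T (u n) \<Longrightarrow> f (u (Suc n)) \<le> f z + (1/2) ^ n"
  proof -
    have "\<exists>u. \<forall>n. ((n = 0 \<longrightarrow> u n = x) \<and> u n \<in> S) \<and>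
        (u (Suc n) \<in> T (u n) \<and> (\<forall>z\<in>T (u n). f (u (Suc n)) \<le> f z + (1/2) ^ n))"
      using x step by (intro dependent_nat_choice) auto
    then show thesis using that by blast
  qed
  have uT_le: "u m \<in> T (u n)" if "n \<le> m" for n m
    using that by (induction m rule: dec_induct) (use T_refl uS uT T_trans in blast)+
  then have u_dist: "f (u m) + e * dist (u n) (u m) \<le> f (u n)" if "n \<le> m" for n m
    using that unfolding T_def by blast
  have "Cauchy (\<lambda>n. f (u n))"
  proof -
    have "decseq (\<lambda>n. f (u n))"
      using u_dist e by (intro decseq_SucI) (smt (verit) Suc_n_not_le_n linorder_linear mult_nonneg_nonneg zero_le_dist)
    then have "convergent (\<lambda>n. f (u n))"
      using lower[OF uS] by (metis decseq_convergent convergent_def)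
    then show ?thesis by (simp add: Cauchy_convergent_iff)
  qed
  have "Cauchy u"
  proof (rule metric_CauchyI)
    fix d :: real assume "0 < d"
    then obtain N where N: "\<And>m n. m \<ge> N \<Longrightarrow> n \<ge> N \<Longrightarrow> dist (f (u m)) (f (u n)) < e * d"
      using \<open>Cauchy (\<lambda>n. f (u n))\<close> e metric_CauchyD[of "\<lambda>n. f (u n)" "e * d"] by auto
    have le: "dist (u m) (u n) < d" if "N \<le> m" "m \<le> n" for m n
    proof -
      have "e * dist (u m) (u n) \<le> f (u m) - f (u n)" using u_dist[OF that(2)] by simp
      also have "\<dots> < e * d" using N[of m n] that by (auto simp: dist_real_def)
      finally show ?thesis using e by simp
    qed
    show "\<exists>M. \<forall>m\<ge>M. \<forall>n\<ge>M. dist (u m) (u n) < d"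
      using le by (metis dist_commute linorder_linear)
  qed
  then obtain y where y: "y \<in> S" "u \<longlonglongrightarrow> y"
    using S uS unfolding complete_def by blast
  have yT: "y \<in> T (u n)" for n
  proof -
    have "f y \<le> f (u n) - e * dist (u n) y + d" if "0 < d" for d
    proof -
      have "(\<lambda>k. e * dist (u n) (u k)) \<longlonglongrightarrow> e * dist (u n) y"
        by (intro tendsto_intros y)
      then have "\<forall>\<^sub>F k in sequentially. e * dist (u n) (u k) > e * dist (u n) y - d"
        using that by (intro order_tendstoD) auto
      then have "\<forall>\<^sub>F k in sequentially. u k \<in> {z \<in> S. f z \<le> f (u n) - e * dist (u n) y + d}"
        using eventually_ge_at_top[of n]
      proof eventually_elim
        case (elim k)
        then show ?case using u_dist[of n k] uS[of k] by simp
      qed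
      from Lim_in_closed_set[OF lsc this _ y(2)] show ?thesis by simp
    qed
    then have "f y \<le> f (u n) - e * dist (u n) y" by (rule field_le_epsilon)
    then show ?thesis using y(1) unfolding T_def by simp
  qed
  have y_min: "f y \<le> f z + e * dist y z" if "z \<in> S" for z
  proof (rule ccontr)
    assume neg: "\<not> ?thesis"
    then have z: "z \<in> T y" using that unfolding T_def by simp
    have "f y \<le> f z + (1/2) ^ n" for n
    proof -
      have "f y \<le> f (u (Suc n))"
        using yT[of "Suc n"] e unfolding T_def by (smt (verit) mem_Collect_eq mult_nonneg_nonneg zero_le_dist)
      also have "\<dots> \<le> f z + (1/2) ^ n" by (rule u_min[OF T_trans[OF yT z]])
      finally show ?thesis .
    qed
    moreover have "(\<lambda>n. f z + (1/2) ^ n) \<longlonglongrightarrow> f z + 0"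
      by (intro tendsto_intros LIMSEQ_power_zero) simp
    ultimately have "f y \<le> f z + 0" by (intro LIMSEQ_le_const) auto
    with neg e show False
      by (smt (verit) mult_nonneg_nonneg zero_le_dist)
  qed
  show thesis
    using that[OF y(1) _ y_min] yT[of 0] u0 unfolding T_def by simp
qed

text \<open>The form in which the principle produces almost critical points. The slack \<open>e * d / 2\<close> keeps the
  Ekeland point within half the radius of the ball, so that it is an interior point and may be
  compared with its neighbours in every direction.\<close>

lemma ekeland_fderiv:
  fixes f :: "'a::banach \<Rightarrow> real"
  assumes C1: "C1 f" and e: "0 < e" and d: "0 < d"
    and lower: "\<And>y. dist x y \<le> d \<Longrightarrow> f x - e * d / 2 \<le> f y"
  obtains y where "dist x y \<le> d / 2" "f y \<le> f x" "norm (fderiv f y) \<le> e"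
proof -
  have "closed {y \<in> cball x d. f y \<le> a}" for a
  proof -
    have "{y \<in> cball x d. f y \<le> a} = cball x d \<inter> {y. f y \<le> a}" by auto
    moreover have "closed {y. f y \<le> a}"
      by (intro closed_Collect_le C1_continuous_on C1 continuous_intros)
    ultimately show ?thesis by auto
  qed
  then obtain y where y: "y \<in> cball x d" "f y + e * dist x y \<le> f x"
    "\<And>z. z \<in> cball x d \<Longrightarrow> f y \<le> f z + e * dist y z"
    using ekeland[of "cball x d" x e "f x - e * d / 2" f] d e lower
    by (auto simp: complete_eq_closed)
  have "e * dist x y \<le> e * (d / 2)"
    using y(2) lower[of y] y(1) by simp
  then have near: "dist x y \<le> d / 2" using e by simp
  have "norm (fderiv f y) \<le> e"
  proof (rule ccontr)
    assume "\<not> ?thesis"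
    then obtain v where v: "norm v \<le> 1" "e < blinfun_apply (fderiv f y) v"
      using blinfun_norm_gt_witness[of e "fderiv f y"] e by auto
    \<comment> \<open>Moving from \<open>y\<close> a short way along \<open>- v\<close> lowers \<open>f\<close> at a rate above \<open>e\<close>.\<close>
    have lim: "(\<lambda>\<tau>. blinfun_apply (fderiv f (y + \<tau> *\<^sub>R (- v))) v) \<midarrow>0\<rightarrow> blinfun_apply (fderiv f (y + 0 *\<^sub>R (- v))) v"
      using C1 unfolding C1_def
      by (intro tendsto_intros continuous_on_tendsto_compose[of UNIV "fderiv f"]) auto
    then have "\<forall>\<^sub>F \<tau> in at 0. e < blinfun_apply (fderiv f (y + \<tau> *\<^sub>R (- v))) v"
      using v(2) by (intro order_tendstoD[OF lim]) simp
    then obtain \<delta> where \<delta>: "0 < \<delta>"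
      "\<And>\<tau>. \<tau> \<noteq> 0 \<Longrightarrow> dist \<tau> 0 < \<delta> \<Longrightarrow> e < blinfun_apply (fderiv f (y + \<tau> *\<^sub>R (- v))) v"
      unfolding eventually_at by blast
    define s where "s = min (\<delta> / 2) (d / 2)"
    have s: "0 < s" "s < \<delta>" "s \<le> d / 2" using \<delta>(1) d unfolding s_def by auto
    obtain \<theta> where \<theta>: "0 < \<theta>" "\<theta> < s"
      "f (y + s *\<^sub>R (- v)) - f y = s * blinfun_apply (fderiv f (y + \<theta> *\<^sub>R (- v))) (- v)"
      using C1_mean_value[OF C1 s(1)] by blast
    have dist_s: "dist y (y + s *\<^sub>R (- v)) \<le> s"
      using v(1) s(1) by (simp add: dist_norm mult_left_le)
    have "e < blinfun_apply (fderiv f (y + \<theta> *\<^sub>R (- v))) v"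
      using \<theta> s by (intro \<delta>(2)) auto
    then have "f (y + s *\<^sub>R (- v)) < f y - s * e"
      using \<theta>(3) mult_strict_left_mono[OF _ s(1)] by (fastforce simp: blinfun.minus_right)
    moreover have "dist x (y + s *\<^sub>R (- v)) \<le> d"
      using dist_triangle[of x "y + s *\<^sub>R (- v)" y] near dist_s s(3) by linarith
    then have "f y \<le> f (y + s *\<^sub>R (- v)) + e * dist y (y + s *\<^sub>R (- v))"
      by (intro y(3)) simp
    moreover have "e * dist y (y + s *\<^sub>R (- v)) \<le> s * e"
      using dist_s e by (simp add: mult.commute)
    ultimately show False by linarith
  qed
  moreover have "f y \<le> f x" using y(2) e by (smt (verit) mult_nonneg_nonneg zero_le_dist)
  ultimately show thesis using that near by blast
qed

section \<open>The Palais--Smale condition\<close>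

text \<open>The sequence is only required to converge along a subsequence; for a \<open>C\<^sup>1\<close> functional
  the limit is then a critical point, and its value is the limit of the values.\<close>

definition palais_smale :: "('a::real_normed_vector \<Rightarrow> real) \<Rightarrow> bool" where
  "palais_smale f \<longleftrightarrow>
     (\<forall>u. bounded (range (\<lambda>n. f (u n))) \<longrightarrow> (\<lambda>n. fderiv f (u n)) \<longlonglongrightarrow> 0 \<longrightarrow>
       (\<exists>k l. strict_mono (k :: nat \<Rightarrow> nat) \<and> (u \<circ> k) \<longlonglongrightarrow> l))"

lemma palais_smaleE:
  assumes ps: "palais_smale f" and C1: "C1 f"
    and bounded: "\<And>n. a \<le> f (u n)" "\<And>n. f (u n) \<le> b"
    and small: "\<And>n. norm (fderiv f (u n)) \<le> e n" "e \<longlonglongrightarrow> 0"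
  obtains k l where "strict_mono (k :: nat \<Rightarrow> nat)" "(u \<circ> k) \<longlonglongrightarrow> l" "fderiv f l = 0"
    "(\<lambda>n. f (u (k n))) \<longlonglongrightarrow> f l"
proof -
  have "bounded (range (\<lambda>n. f (u n)))"
    by (rule bounded_subset[of "{a..b}"]) (use bounded in auto)
  moreover have lim: "(\<lambda>n. fderiv f (u n)) \<longlonglongrightarrow> 0"
    by (rule Lim_null_comparison[OF _ small(2)]) (use small(1) in auto)
  ultimately obtain k l where k: "strict_mono (k :: nat \<Rightarrow> nat)" "(u \<circ> k) \<longlonglongrightarrow> l"
    using ps unfolding palais_smale_def by blast
  have "(\<lambda>n. fderiv f ((u \<circ> k) n)) \<longlonglongrightarrow> 0"
    using LIMSEQ_subseq_LIMSEQ[OF lim k(1)] by (simp add: o_def)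
  then have "fderiv f l = 0"
    using C1_fderiv_tendsto[OF C1 k(2)] LIMSEQ_unique by blast
  with that[OF k] C1_tendsto[OF C1 k(2)] show thesis by simp
qed

text \<open>A minimizing sequence need not have small derivatives, but by Ekeland's principle it may be replaced
  by one that does.\<close>

lemma palais_smale_global_min:
  fixes f :: "'a::banach \<Rightarrow> real"
  assumes C1: "C1 f" and ps: "palais_smale f" and lower: "\<And>x. c \<le> f x"
  shows "\<exists>x. global_min f x"
proof -
  define m where "m = Inf (range f)"
  have bdd: "bdd_below (range f)" using lower by (intro bdd_belowI[of _ c]) auto
  have m: "m \<le> f x" for x unfolding m_def by (intro cInf_lower bdd) auto
  define e where "e n = inverse (real (Suc n))" for n
  have e: "0 < e n" "e n \<le> 1" for n unfolding e_def by (auto simp: field_simps)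
  have e_lim: "e \<longlonglongrightarrow> 0" unfolding e_def by (rule LIMSEQ_inverse_real_of_nat)
  have "\<exists>y. f y \<le> m + e n / 2 \<and> norm (fderiv f y) \<le> e n" for n
  proof -
    have "Inf (range f) < m + e n * 1 / 2" using e(1)[of n] unfolding m_def by simp
    then obtain x where x: "f x < m + e n * 1 / 2"
      using cInf_lessD[of "range f" "m + e n * 1 / 2"] by auto
    then have "f x - e n * 1 / 2 \<le> f y" for y using m[of y] by simp
    then obtain y where "f y \<le> f x" "norm (fderiv f y) \<le> e n"
      using ekeland_fderiv[OF C1 e(1)[of n] zero_less_one, of x] by blast
    with x show ?thesis by (intro exI[of _ y]) auto
  qed
  then obtain u where u: "\<And>n. f (u n) \<le> m + e n / 2" "\<And>n. norm (fderiv f (u n)) \<le> e n"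
    by metis
  have "f (u n) \<le> m + 1" for n using u(1)[of n] e(2)[of n] by simp
  then obtain k l where k: "strict_mono (k :: nat \<Rightarrow> nat)" "(\<lambda>n. f (u (k n))) \<longlonglongrightarrow> f l"
    using palais_smaleE[OF ps C1 m _ u(2) e_lim] by metis
  have "(\<lambda>n. m + e n / 2) \<longlonglongrightarrow> m + 0 / 2" by (intro tendsto_intros e_lim) simp
  from LIMSEQ_subseq_LIMSEQ[OF this k(1)] have "f l \<le> m + 0 / 2"
    by (intro LIMSEQ_le[OF k(2)]) (use u(1) in \<open>auto simp: o_def\<close>)
  with m show ?thesis unfolding global_min_def by (metis add_0_right div_0 order_trans)
qed

text \<open>In infinite dimensions a strict local minimum need not leave a positive gap on small spheres, since
  these are not compact. If there were no gap, Ekeland's principle would move points of the sphere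
  to almost critical points in a surrounding shell, still with values tending to \<open>f a\<close>; their limit
  would be a point of the shell at which \<open>f\<close> is at most \<open>f a\<close>.\<close>

lemma strict_local_min_sphere_gap:
  fixes f :: "'a::banach \<Rightarrow> real"
  assumes C1: "C1 f" and ps: "palais_smale f" and loc: "strict_local_min f a" and d: "0 < d"
  obtains \<rho> \<beta> where "0 < \<rho>" "\<rho> < d" "f a < \<beta>" "\<And>x. dist a x = \<rho> \<Longrightarrow> \<beta> \<le> f x"
proof -
  obtain R where R: "0 < R" "\<And>x. x \<noteq> a \<Longrightarrow> dist x a < R \<Longrightarrow> f a < f x"
    using loc unfolding strict_local_min_def eventually_at by blast
  define \<rho> where "\<rho> = min (R / 3) (d / 2)"
  have \<rho>: "0 < \<rho>" "\<rho> < d" "3 * \<rho> \<le> R" using R(1) d unfolding \<rho>_def by auto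
  \<comment> \<open>All balls of radius \<open>\<rho>\<close> around points of the sphere stay where \<open>f a\<close> is the minimum.\<close>
  have low: "f a \<le> f y" if "dist a y \<le> 2 * \<rho>" for y
    using R(2)[of y] that \<rho> by (cases "y = a") (auto simp: dist_commute)
  define e where "e n = inverse (real (Suc n))" for n
  have e: "0 < e n" "e n \<le> 1" for n unfolding e_def by (auto simp: field_simps)
  have e_lim: "e \<longlonglongrightarrow> 0" unfolding e_def by (rule LIMSEQ_inverse_real_of_nat)
  have "\<exists>n. \<forall>x. dist a x = \<rho> \<longrightarrow> f a + e n * \<rho> / 2 \<le> f x"
  proof (rule ccontr)
    assume "\<not> ?thesis"
    then have "\<exists>x. dist a x = \<rho> \<and> f x < f a + e n * \<rho> / 2" for n by (auto simp: not_le)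
    then obtain x where x: "\<And>n. dist a (x n) = \<rho>" "\<And>n. f (x n) < f a + e n * \<rho> / 2" by metis
    have "\<exists>y. dist (x n) y \<le> \<rho> / 2 \<and> f y \<le> f (x n) \<and> norm (fderiv f y) \<le> e n" for n
    proof -
      have "f (x n) - e n * \<rho> / 2 \<le> f y" if "dist (x n) y \<le> \<rho>" for y
        using low[of y] dist_triangle[of a y "x n"] x[of n] that by linarith
      then show ?thesis using ekeland_fderiv[OF C1 e(1)[of n] \<rho>(1), of "x n"] by metis
    qed
    then obtain y where y: "\<And>n. dist (x n) (y n) \<le> \<rho> / 2" "\<And>n. f (y n) \<le> f (x n)"
      "\<And>n. norm (fderiv f (y n)) \<le> e n" by metis
    have y_dist: "\<rho> / 2 \<le> dist a (y n)" "dist a (y n) \<le> 2 * \<rho>" for n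
      using y(1)[of n] x(1)[of n] dist_triangle[of a "y n" "x n"] dist_triangle[of a "x n" "y n"] \<rho>(1)
      by (simp_all add: dist_commute)
    have y_up: "f (y n) \<le> f a + e n * \<rho> / 2" for n using y(2)[of n] x(2)[of n] by simp
    have "f (y n) \<le> f a + \<rho> / 2" for n
      using y_up[of n] mult_right_mono[OF e(2)[of n], of \<rho>] \<rho>(1) by linarith
    then obtain k l where k: "strict_mono (k :: nat \<Rightarrow> nat)" "(y \<circ> k) \<longlonglongrightarrow> l"
      "(\<lambda>n. f (y (k n))) \<longlonglongrightarrow> f l"
      using palais_smaleE[OF ps C1 low[OF y_dist(2)] _ y(3) e_lim] by metis
    have "(\<lambda>n. dist a ((y \<circ> k) n)) \<longlonglongrightarrow> dist a l" by (intro tendsto_intros k)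
    then have l: "\<rho> / 2 \<le> dist a l" "dist a l \<le> 2 * \<rho>"
      using LIMSEQ_le_const LIMSEQ_le_const2 y_dist by (metis comp_apply)+
    have "(\<lambda>n. f a + e n * \<rho> / 2) \<longlonglongrightarrow> f a + 0 * \<rho> / 2" by (intro tendsto_intros e_lim) simp
    from LIMSEQ_subseq_LIMSEQ[OF this k(1)] have "f l \<le> f a + 0 * \<rho> / 2"
      by (intro LIMSEQ_le[OF k(3)]) (use y_up in \<open>auto simp: o_def\<close>)
    moreover have "f a < f l" using l \<rho> R(2)[of l] by (cases "l = a") (auto simp: dist_commute)
    ultimately show False by simp
  qed
  then obtain n where "\<And>x. dist a x = \<rho> \<Longrightarrow> f a + e n * \<rho> / 2 \<le> f x" by blast
  then show thesis using that[of \<rho> "f a + e n * \<rho> / 2"] \<rho> e(1)[of n] by simp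
qed

section \<open>The mountain pass theorem\<close>

text \<open>Near each point of \<open>M\<close> a constant direction works; these are glued with weights that are distances to
  the complements of a finite cover. The term \<open>infdist s M\<close> in the denominator makes the quotient
  continuous on the whole line without changing it on \<open>M\<close>, and since the cover avoids \<open>0\<close> and \<open>1\<close>,
  the field vanishes there: moving a path along it keeps its end points.\<close>

lemma descent_direction_along_path:
  fixes A :: "real \<Rightarrow> 'a::real_normed_vector \<Rightarrow>\<^sub>L real"
  assumes M: "compact M" "M \<noteq> {}" "M \<subseteq> {0<..<1}" and A: "continuous_on UNIV A"
    and e: "0 \<le> e" and large: "\<And>t. t \<in> M \<Longrightarrow> e < norm (A t)"
  obtains \<xi> where "continuous_on UNIV \<xi>" "\<And>t. norm (\<xi> t) \<le> 1" "\<xi> 0 = 0" "\<xi> 1 = 0"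
    "\<And>t. t \<in> M \<Longrightarrow> e < blinfun_apply (A t) (\<xi> t)"
proof -
  have "\<exists>v. norm v \<le> 1 \<and> e < blinfun_apply (A t) v" if "t \<in> M" for t
    using blinfun_norm_gt_witness[OF e large[OF that]] by blast
  then obtain v where v: "\<And>t. t \<in> M \<Longrightarrow> norm (v t) \<le> 1"
    "\<And>t. t \<in> M \<Longrightarrow> e < blinfun_apply (A t) (v t)" by metis
  define U where "U t = {0<..<1} \<inter> {s. e < blinfun_apply (A s) (v t)}" for t
  have U_open: "open (U t)" for t
    unfolding U_def by (intro open_Int open_Collect_less continuous_intros A)
  have U_self: "t \<in> U t" if "t \<in> M" for t using that v M(3) unfolding U_def by auto
  obtain C where C: "C \<subseteq> M" "finite C" "M \<subseteq> (\<Union>t\<in>C. U t)"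
    using compactE_image[OF M(1), of M U] U_open U_self by blast
  define w where "w t s = infdist s (- U t)" for t s
  have U_compl: "closed (- U t)" "0 \<in> - U t" "1 \<in> - U t" for t
    using U_open[of t] by (simp_all add: closed_Compl) (simp_all add: U_def)
  have w_nonneg: "0 \<le> w t s" for t s unfolding w_def by (rule infdist_nonneg)
  have w_pos: "0 < w t s \<longleftrightarrow> s \<in> U t" for t s
    unfolding w_def using in_closed_iff_infdist_zero[OF U_compl(1)] U_compl(2)
    by (metis ComplD ComplI empty_iff infdist_nonneg order_less_le)
  define W where "W s = (\<Sum>t\<in>C. w t s)" for s
  define D where "D s = W s + infdist s M" for s
  have W_nonneg: "0 \<le> W s" for s unfolding W_def by (intro sum_nonneg w_nonneg)
  have W_pos: "0 < W s" if "s \<in> M" for s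
  proof -
    obtain t where "t \<in> C" "s \<in> U t" using C(3) \<open>s \<in> M\<close> by blast
    then show ?thesis
      unfolding W_def using C(2) w_nonneg w_pos by (intro sum_pos2[of _ t]) auto
  qed
  have D_pos: "0 < D s" for s
  proof (cases "s \<in> M")
    case True
    then show ?thesis using W_pos infdist_nonneg[of s M] unfolding D_def by (simp add: add_pos_nonneg)
  next
    case False
    then have "infdist s M \<noteq> 0"
      using in_closed_iff_infdist_zero[OF compact_imp_closed[OF M(1)] M(2)] by blast
    then show ?thesis
      using infdist_nonneg[of s M] W_nonneg[of s] unfolding D_def by linarith
  qed
  define \<xi> where "\<xi> s = inverse (D s) *\<^sub>R (\<Sum>t\<in>C. w t s *\<^sub>R v t)" for s
  show thesis
  proof
    show "continuous_on UNIV \<xi>"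
    proof -
      have w_cont: "continuous_on UNIV (w t)" for t
        unfolding w_def by (intro continuous_intros)
      have "continuous_on UNIV D" unfolding D_def W_def by (intro continuous_intros w_cont)
      then show ?thesis
        unfolding \<xi>_def by (intro continuous_intros w_cont) (use D_pos in \<open>auto simp: less_le\<close>)
    qed
    show "norm (\<xi> s) \<le> 1" for s
    proof -
      have "norm (\<Sum>t\<in>C. w t s *\<^sub>R v t) \<le> (\<Sum>t\<in>C. w t s)"
      proof (rule sum_norm_le)
        fix t assume "t \<in> C"
        then show "norm (w t s *\<^sub>R v t) \<le> w t s"
          using v(1)[of t] C(1) w_nonneg[of t s] by (auto intro: mult_left_le)
      qed
      also have "\<dots> \<le> D s" unfolding D_def W_def using infdist_nonneg by simp
      finally show ?thesis unfolding \<xi>_def using D_pos[of s] by (simp add: field_simps)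
    qed
    have "w t 0 = 0" "w t 1 = 0" for t unfolding w_def using U_compl(2,3) by simp_all
    then show "\<xi> 0 = 0" "\<xi> 1 = 0" unfolding \<xi>_def by simp_all
    show "e < blinfun_apply (A s) (\<xi> s)" if s: "s \<in> M" for s
    proof -
      have "D s = W s" unfolding D_def using s by simp
      have le: "w t s * e \<le> w t s * blinfun_apply (A s) (v t)" for t
      proof (cases "s \<in> U t")
        case True
        then show ?thesis unfolding U_def using w_nonneg[of t s] by (intro mult_left_mono) auto
      next
        case False
        then show ?thesis using w_pos[of t s] w_nonneg[of t s] by simp
      qed
      obtain t where t: "t \<in> C" "s \<in> U t" using C(3) s by blast
      have "(\<Sum>t\<in>C. w t s * e) < (\<Sum>t\<in>C. w t s * blinfun_apply (A s) (v t))"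
      proof (intro sum_strict_mono_ex1 C(2) ballI le bexI[OF _ t(1)])
        show "w t s * e < w t s * blinfun_apply (A s) (v t)"
          using t(2) w_pos[of t s] unfolding U_def by simp
      qed
      then have "D s * e < blinfun_apply (A s) (\<Sum>t\<in>C. w t s *\<^sub>R v t)"
        unfolding \<open>D s = W s\<close> W_def
        by (simp add: sum_distrib_right blinfun.sum_right blinfun.scaleR_right)
      then show ?thesis
        unfolding \<xi>_def using D_pos[of s] by (simp add: blinfun.scaleR_right field_simps)
    qed
  qed
qed

text \<open>Paths are bounded continuous functions on the whole line, whose type is a complete metric space; only
  their values on \<open>[0, 1]\<close> are used.\<close>

definition path_max :: "('a::metric_space \<Rightarrow> real) \<Rightarrow> (real \<Rightarrow>\<^sub>C 'a) \<Rightarrow> real" where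
  "path_max f g = (SUP t\<in>{0..1}. f (g t))"

lemma path_max_attained:
  assumes "continuous_on UNIV f"
  obtains t where "t \<in> {0..1}" "f (apply_bcontfun g t) = path_max f g"
    "\<And>s. s \<in> {0..1} \<Longrightarrow> f (apply_bcontfun g s) \<le> path_max f g"
proof -
  have "continuous_on {0..1} (\<lambda>t. f (apply_bcontfun g t))"
    by (rule continuous_on_compose2[OF assms]) auto
  then obtain t where t: "t \<in> {0..1}"
    "\<And>s. s \<in> {0..1} \<Longrightarrow> f (apply_bcontfun g s) \<le> f (apply_bcontfun g t)"
    using continuous_attains_sup[of "{0..1::real}" "\<lambda>t. f (apply_bcontfun g t)"] by auto
  then have "path_max f g = f (apply_bcontfun g t)"
    unfolding path_max_def by (intro cSup_eq_maximum) auto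
  with t that show thesis by metis
qed

lemma path_max_le_iff:
  assumes "continuous_on UNIV f"
  shows "path_max f g \<le> a \<longleftrightarrow> (\<forall>t\<in>{0..1}. f (apply_bcontfun g t) \<le> a)"
  using path_max_attained[OF assms, of g] by (metis order_trans)

lemma closed_path_max_sublevel:
  assumes "continuous_on UNIV f"
  shows "closed {g. path_max f g \<le> a}"
proof -
  have "continuous_on UNIV (\<lambda>g. f (apply_bcontfun g t))" for t
  proof (rule continuous_on_compose2[OF assms])
    have "1-lipschitz_on UNIV (\<lambda>g. apply_bcontfun g t)"
      by (rule lipschitz_onI) (auto intro: dist_bounded)
    then show "continuous_on UNIV (\<lambda>g. apply_bcontfun g t)"
      by (rule lipschitz_on_continuous_on)
  qed auto
  then have "closed (\<Inter>t\<in>{0..1}. {g. f (apply_bcontfun g t) \<le> a})"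
    by (intro closed_INT ballI closed_Collect_le continuous_intros)
  moreover have "{g. path_max f g \<le> a} = (\<Inter>t\<in>{0..1}. {g. f (apply_bcontfun g t) \<le> a})"
    using path_max_le_iff[OF assms] by auto
  ultimately show ?thesis by simp
qed

text \<open>If \<open>f\<close> had slope above \<open>e\<close> at all highest points of \<open>g\<close>, a descent field along \<open>g\<close> could be used to push
  the path down. By \<open>opt\<close> the push by \<open>s\<close> lowers the maximum by at most \<open>e * s\<close>. The highest points of
  the pushed paths accumulate at a highest point of \<open>g\<close> as \<open>s\<close> tends to \<open>0\<close>, and there the mean value
  theorem bounds the slope along the field by \<open>e\<close>.\<close>

lemma almost_critical_on_optimal_path:
  fixes f :: "'a::banach \<Rightarrow> real"
  assumes C1: "C1 f" and e: "0 < e"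
    and ends: "f (apply_bcontfun g 0) < path_max f g" "f (apply_bcontfun g 1) < path_max f g"
    and opt: "\<And>h. apply_bcontfun h 0 = apply_bcontfun g 0 \<Longrightarrow>
        apply_bcontfun h 1 = apply_bcontfun g 1 \<Longrightarrow> path_max f g \<le> path_max f h + e * dist g h"
  obtains t where "f (apply_bcontfun g t) = path_max f g" "norm (fderiv f (apply_bcontfun g t)) \<le> e"
proof (rule ccontr)
  note cont = C1_continuous_on[OF C1]
  define M where "M = {t \<in> {0..1}. f (apply_bcontfun g t) = path_max f g}"
  assume "\<not> thesis"
  then have large: "e < norm (fderiv f (apply_bcontfun g t))" if "t \<in> M" for t
    using that \<open>\<And>t. _ \<Longrightarrow> _ \<Longrightarrow> thesis\<close> unfolding M_def by force
  have M_alt: "M = {0..1} \<inter> {t. f (apply_bcontfun g t) = path_max f g}" unfolding M_def by auto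
  have "closed {t. f (apply_bcontfun g t) = path_max f g}"
    by (intro closed_Collect_eq continuous_on_compose2[OF cont] continuous_intros) auto
  then have "compact M" unfolding M_alt by (intro compact_Int_closed) auto
  moreover have "M \<noteq> {}" using path_max_attained[OF cont, of g] unfolding M_def by blast
  moreover have "M \<subseteq> {0<..<1}" using ends unfolding M_def by (force simp: order_less_le)
  moreover have "continuous_on UNIV (\<lambda>t. fderiv f (apply_bcontfun g t))"
    by (rule continuous_on_compose2[of UNIV "fderiv f"]) (use C1 in \<open>auto simp: C1_def\<close>)
  ultimately obtain \<xi> where \<xi>: "continuous_on UNIV \<xi>" "\<And>t. norm (\<xi> t) \<le> 1" "\<xi> 0 = 0" "\<xi> 1 = 0"
    "\<And>t. t \<in> M \<Longrightarrow> e < blinfun_apply (fderiv f (apply_bcontfun g t)) (\<xi> t)"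
    using descent_direction_along_path[of M "\<lambda>t. fderiv f (apply_bcontfun g t)" e] e large by auto
  define X where "X = Bcontfun \<xi>"
  have X: "apply_bcontfun X = \<xi>"
    unfolding X_def by (intro Bcontfun_inverse bcontfun_normI[of _ 1] \<xi>)
  define s where "s n = inverse (real (Suc n))" for n
  have s_pos: "0 < s n" for n unfolding s_def by simp
  have s_lim: "s \<longlonglongrightarrow> 0" unfolding s_def by (rule LIMSEQ_inverse_real_of_nat)
  define h where "h n = g - s n *\<^sub>R X" for n
  have h: "apply_bcontfun (h n) t = apply_bcontfun g t + s n *\<^sub>R (- \<xi> t)" for n t
    unfolding h_def by (simp add: X)
  have h_opt: "path_max f g \<le> path_max f (h n) + e * s n" for n
  proof -
    have "dist g (h n) \<le> s n"
      using \<xi>(2) s_pos[of n] by (intro dist_bound) (simp add: h dist_norm mult_left_le)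
    then have "e * dist g (h n) \<le> e * s n" using e by simp
    moreover have "path_max f g \<le> path_max f (h n) + e * dist g (h n)"
      by (rule opt) (simp_all add: h \<xi>)
    ultimately show ?thesis by linarith
  qed
  have "\<exists>t\<in>{0..1}. f (apply_bcontfun (h n) t) = path_max f (h n)" for n
    using path_max_attained[OF cont] by metis
  then obtain t where t: "\<And>n. t n \<in> {0..1::real}"
    "\<And>n. f (apply_bcontfun (h n) (t n)) = path_max f (h n)" by metis
  obtain \<tau> k where k: "\<tau> \<in> {0..1}" "strict_mono (k :: nat \<Rightarrow> nat)" "(t \<circ> k) \<longlonglongrightarrow> \<tau>"
    using compact_Icc[of "0::real" 1] t(1) unfolding compact_def by blast
  have "\<exists>\<theta>. 0 < \<theta> \<and> \<theta> < s n \<and>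
      f (apply_bcontfun (h n) (t n)) - f (apply_bcontfun g (t n)) =
      s n * blinfun_apply (fderiv f (apply_bcontfun g (t n) + \<theta> *\<^sub>R (- \<xi> (t n)))) (- \<xi> (t n))" for n
    using C1_mean_value[OF C1 s_pos[of n], of "apply_bcontfun g (t n)" "- \<xi> (t n)"] unfolding h by blast
  then obtain \<theta> where \<theta>: "\<And>n. 0 < \<theta> n" "\<And>n. \<theta> n < s n"
    and mv: "\<And>n. f (apply_bcontfun (h n) (t n)) - f (apply_bcontfun g (t n)) =
      s n * blinfun_apply (fderiv f (apply_bcontfun g (t n) + \<theta> n *\<^sub>R (- \<xi> (t n)))) (- \<xi> (t n))"
    by metis
  have slope: "blinfun_apply (fderiv f (apply_bcontfun g (t n) + \<theta> n *\<^sub>R (- \<xi> (t n)))) (\<xi> (t n)) \<le> e" for n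
  proof -
    have "f (apply_bcontfun g (t n)) \<le> path_max f g"
      using path_max_attained[OF cont, of g] t(1)[of n] by metis
    then have "s n * blinfun_apply (fderiv f (apply_bcontfun g (t n) + \<theta> n *\<^sub>R (- \<xi> (t n)))) (\<xi> (t n)) \<le> s n * e"
      using mv[of n] h_opt[of n] t(2)[of n] by (simp add: blinfun.minus_right mult.commute)
    then show ?thesis using s_pos[of n] by simp
  qed
  have sk: "(\<lambda>n. s (k n)) \<longlonglongrightarrow> 0" using LIMSEQ_subseq_LIMSEQ[OF s_lim k(2)] by (simp add: o_def)
  have \<theta>k: "(\<lambda>n. \<theta> (k n)) \<longlonglongrightarrow> 0"
    by (rule Lim_null_comparison[OF _ sk]) (use \<theta> in \<open>simp add: abs_of_pos less_imp_le\<close>)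
  have tk: "(\<lambda>n. t (k n)) \<longlonglongrightarrow> \<tau>" using k(3) by (simp add: o_def)
  have gk: "(\<lambda>n. apply_bcontfun g (t (k n))) \<longlonglongrightarrow> apply_bcontfun g \<tau>"
    by (rule continuous_on_tendsto_compose[of UNIV _ _ \<tau>]) (use tk in auto)
  have \<xi>k: "(\<lambda>n. \<xi> (t (k n))) \<longlonglongrightarrow> \<xi> \<tau>"
    by (rule continuous_on_tendsto_compose[OF \<xi>(1) tk]) auto
  have "(\<lambda>n. f (apply_bcontfun (h (k n)) (t (k n))) + e * s (k n)) \<longlonglongrightarrow>
      f (apply_bcontfun g \<tau> + 0 *\<^sub>R (- \<xi> \<tau>)) + e * 0"
    unfolding h by (intro tendsto_intros C1_tendsto[OF C1] gk \<xi>k sk)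
  then have "path_max f g \<le> f (apply_bcontfun g \<tau> + 0 *\<^sub>R (- \<xi> \<tau>)) + e * 0"
    by (rule LIMSEQ_le_const) (use h_opt t(2) in auto)
  moreover have "f (apply_bcontfun g \<tau>) \<le> path_max f g"
    using path_max_attained[OF cont, of g] k(1) by metis
  ultimately have "\<tau> \<in> M" using k(1) unfolding M_def by simp
  have "(\<lambda>n. blinfun_apply (fderiv f (apply_bcontfun g (t (k n)) + \<theta> (k n) *\<^sub>R (- \<xi> (t (k n))))) (\<xi> (t (k n))))
      \<longlonglongrightarrow> blinfun_apply (fderiv f (apply_bcontfun g \<tau> + 0 *\<^sub>R (- \<xi> \<tau>))) (\<xi> \<tau>)"
    by (intro tendsto_intros C1_fderiv_tendsto[OF C1] gk \<xi>k \<theta>k)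
  then have "blinfun_apply (fderiv f (apply_bcontfun g \<tau> + 0 *\<^sub>R (- \<xi> \<tau>))) (\<xi> \<tau>) \<le> e"
    by (rule LIMSEQ_le_const2) (use slope in auto)
  with \<xi>(5)[OF \<open>\<tau> \<in> M\<close>] show False by simp
qed

text \<open>Every path from \<open>a\<close> to \<open>b\<close> crosses the sphere, so its maximum is at least \<open>\<beta>\<close>. Ekeland's principle on the
  space of paths, applied to the maximum along a path, gives almost optimal paths, and these have
  almost critical highest points.\<close>

theorem mountain_pass:
  fixes f :: "'a::banach \<Rightarrow> real"
  assumes C1: "C1 f" and ps: "palais_smale f"
    and \<rho>: "0 < \<rho>" "\<rho> < dist a b"
    and gap: "f a < \<beta>" "f b < \<beta>" "\<And>x. dist a x = \<rho> \<Longrightarrow> \<beta> \<le> f x"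
  obtains w where "fderiv f w = 0" "\<beta> \<le> f w"
proof -
  note cont = C1_continuous_on[OF C1]
  define S where "S = {g :: real \<Rightarrow>\<^sub>C 'a. apply_bcontfun g 0 = a \<and> apply_bcontfun g 1 = b}"
  have S_closed: "closed S"
  proof -
    have "S = PiC {0, 1} (\<lambda>t. if t = 0 then {a} else {b})"
      unfolding S_def mem_PiC_iff set_eq_iff by (auto simp: Pi_iff)
    then show ?thesis by (simp add: closed_PiC)
  qed
  define g0 where "g0 = Bcontfun (\<lambda>t. a + max 0 (min 1 t) *\<^sub>R (b - a))"
  have "apply_bcontfun g0 = (\<lambda>t. a + max 0 (min 1 t) *\<^sub>R (b - a))"
    unfolding g0_def
  proof (intro Bcontfun_inverse bcontfun_normI[of _ "norm a + norm (b - a)"])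
    show "continuous_on UNIV (\<lambda>t::real. a + max 0 (min 1 t) *\<^sub>R (b - a))"
      by (intro continuous_intros)
    show "norm (a + max 0 (min 1 t) *\<^sub>R (b - a)) \<le> norm a + norm (b - a)" for t :: real
      by (rule order_trans[OF norm_triangle_ineq]) (auto intro: mult_left_le_one_le)
  qed
  then have g0: "g0 \<in> S" unfolding S_def by simp
  have high: "\<beta> \<le> path_max f g" if "g \<in> S" for g
  proof -
    have "\<exists>t\<ge>0. t \<le> 1 \<and> dist a (apply_bcontfun g t) = \<rho>"
      using that \<rho> by (intro IVT') (auto simp: S_def intro!: continuous_intros)
    then obtain t where t: "t \<in> {0..1}" "dist a (apply_bcontfun g t) = \<rho>" by auto
    then have "\<beta> \<le> f (apply_bcontfun g t)" by (intro gap(3))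
    also have "\<dots> \<le> path_max f g" using path_max_attained[OF cont, of g] t(1) by metis
    finally show ?thesis .
  qed
  define e where "e n = inverse (real (Suc n))" for n
  have e: "0 < e n" for n unfolding e_def by simp
  have e_lim: "e \<longlonglongrightarrow> 0" unfolding e_def by (rule LIMSEQ_inverse_real_of_nat)
  have "\<exists>y. \<beta> \<le> f y \<and> f y \<le> path_max f g0 \<and> norm (fderiv f y) \<le> e n" for n
  proof -
    have "closed {g \<in> S. path_max f g \<le> c}" for c
    proof -
      have "{g \<in> S. path_max f g \<le> c} = S \<inter> {g. path_max f g \<le> c}" by auto
      then show ?thesis using S_closed closed_path_max_sublevel[OF cont] by auto
    qed
    then obtain g where g: "g \<in> S" "path_max f g + e n * dist g0 g \<le> path_max f g0"
      "\<And>h. h \<in> S \<Longrightarrow> path_max f g \<le> path_max f h + e n * dist g h"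
      using ekeland[of S g0 "e n" \<beta> "path_max f"] S_closed g0 e high by (auto simp: complete_eq_closed)
    obtain t where "f (apply_bcontfun g t) = path_max f g" "norm (fderiv f (apply_bcontfun g t)) \<le> e n"
    proof (rule almost_critical_on_optimal_path[OF C1 e[of n], of g])
      show "f (apply_bcontfun g 0) < path_max f g" "f (apply_bcontfun g 1) < path_max f g"
        using g(1) high[OF g(1)] gap(1,2) unfolding S_def by auto
      show "path_max f g \<le> path_max f h + e n * dist g h"
        if "apply_bcontfun h 0 = apply_bcontfun g 0" "apply_bcontfun h 1 = apply_bcontfun g 1" for h
        using g(1) that by (intro g(3)) (simp add: S_def)
    qed
    moreover have "path_max f g \<le> path_max f g0"
      using g(2) e[of n] by (smt (verit) mult_nonneg_nonneg zero_le_dist)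
    ultimately show ?thesis using high[OF g(1)] by metis
  qed
  then obtain u where u: "\<And>n. \<beta> \<le> f (u n)" "\<And>n. f (u n) \<le> path_max f g0"
    "\<And>n. norm (fderiv f (u n)) \<le> e n" by metis
  obtain k l where k: "strict_mono (k :: nat \<Rightarrow> nat)" "fderiv f l = 0" "(\<lambda>n. f (u (k n))) \<longlonglongrightarrow> f l"
    using palais_smaleE[OF ps C1 u e_lim] by metis
  have "\<beta> \<le> f l" by (rule LIMSEQ_le_const[OF k(3)]) (use u(1) in auto)
  with k(2) that show thesis by blast
qed

corollary critical_point_above_strict_local_min:
  fixes f :: "'a::banach \<Rightarrow> real"
  assumes C1: "C1 f" and ps: "palais_smale f" and loc: "strict_local_min f a"
    and b: "b \<noteq> a" "f b \<le> f a"
  obtains w where "critical_point f w" "f a < f w"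
proof -
  obtain \<rho> \<beta> where "0 < \<rho>" "\<rho> < dist a b" "f a < \<beta>" "\<And>x. dist a x = \<rho> \<Longrightarrow> \<beta> \<le> f x"
    using strict_local_min_sphere_gap[OF C1 ps loc, of "dist a b"] b(1) by auto
  then obtain w where "fderiv f w = 0" "\<beta> \<le> f w"
    using mountain_pass[OF C1 ps, of \<rho> a b \<beta>] b(2) by auto
  with \<open>f a < \<beta>\<close> that show thesis using critical_point_iff_fderiv[OF C1] by force
qed

section \<open>Compact derivatives and the Palais--Smale condition\<close>

lemma compact_derivative_add:
  assumes "C1 f" "C1 g" "compact_derivative f" "compact_derivative g"
  shows "compact_derivative (\<lambda>x. f x + g x)"
  unfolding compact_derivative_def
proof (intro allI impI)
  fix B :: "'a set" assume "bounded B"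
  then have c: "compact (closure (fderiv f ` B))" "compact (closure (fderiv g ` B))"
    using assms(3,4) unfolding compact_derivative_def by auto
  let ?S = "{a + b | a b. a \<in> closure (fderiv f ` B) \<and> b \<in> closure (fderiv g ` B)}"
  have "fderiv (\<lambda>x. f x + g x) ` B \<subseteq> ?S"
  proof (rule image_subsetI)
    fix x assume "x \<in> B"
    then have "fderiv f x \<in> closure (fderiv f ` B)" "fderiv g x \<in> closure (fderiv g ` B)"
      using closure_subset[of "fderiv f ` B"] closure_subset[of "fderiv g ` B"] by auto
    then show "fderiv (\<lambda>x. f x + g x) x \<in> ?S"
      unfolding fderiv_add[OF assms(1,2)] by blast
  qed
  then have "closure (fderiv (\<lambda>x. f x + g x) ` B) \<subseteq> ?S"
    by (intro closure_minimal compact_imp_closed compact_sums c)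
  then show "compact (closure (fderiv (\<lambda>x. f x + g x) ` B))"
    using compact_Int_closed[OF compact_sums[OF c] closed_closure] by (metis (no_types, lifting) Int_absorb1)
qed

lemma compact_derivative_cmult:
  fixes c :: real
  assumes "C1 f" "compact_derivative f"
  shows "compact_derivative (\<lambda>x. c * f x)"
  unfolding compact_derivative_def
proof (intro allI impI)
  fix B :: "'a set" assume "bounded B"
  then have "compact (closure (fderiv f ` B))"
    using assms(2) unfolding compact_derivative_def by auto
  moreover have "fderiv (\<lambda>x. c * f x) ` B = (*\<^sub>R) c ` (fderiv f ` B)"
    using fderiv_cmult[OF assms(1)] by (auto simp: image_image)
  ultimately show "compact (closure (fderiv (\<lambda>x. c * f x) ` B))"
    by (simp add: closure_scaleR[symmetric] compact_scaling)
qed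

lemma compact_derivative_norm_bound:
  assumes "compact_derivative f" "bounded B"
  obtains L where "0 \<le> L" "\<And>x. x \<in> B \<Longrightarrow> norm (fderiv f x) \<le> L"
proof -
  have "bounded (fderiv f ` B)"
    using assms bounded_subset[OF compact_imp_bounded closure_subset]
    unfolding compact_derivative_def by blast
  then obtain L where "0 < L" "\<And>y. y \<in> fderiv f ` B \<Longrightarrow> norm y \<le> L"
    unfolding bounded_pos by blast
  then show thesis using that[of L] by auto
qed

text \<open>By the mean value inequality, a derivative bounded on balls makes the functional bounded on
  balls.\<close>

lemma compact_derivative_bounded_on:
  assumes C1: "C1 f" and cd: "compact_derivative f" and B: "bounded B"
  obtains L where "0 \<le> L" "\<And>x. x \<in> B \<Longrightarrow> \<bar>f x\<bar> \<le> L"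
proof -
  obtain R where R: "0 < R" "B \<subseteq> cball 0 R"
    using bounded_subset_ballD[OF B, of 0] ball_subset_cball by (metis order_trans)
  obtain L where L: "0 \<le> L" "\<And>x. x \<in> cball 0 R \<Longrightarrow> norm (fderiv f x) \<le> L"
    by (rule compact_derivative_norm_bound[OF cd bounded_cball[of 0 R]]) blast
  have "\<bar>f x\<bar> \<le> \<bar>f 0\<bar> + L * R" if "x \<in> B" for x
  proof -
    have x: "x \<in> cball 0 R" using that R(2) by blast
    have "norm (f x - f 0) \<le> L * norm (x - 0)"
      using R(1) x L(2)
      by (intro differentiable_bound[of "cball 0 R" f "\<lambda>x. blinfun_apply (fderiv f x)"])
        (auto intro: C1_has_derivative[OF C1] simp flip: norm_blinfun.rep_eq)
    also have "\<dots> \<le> L * R" using x L(1) by (intro mult_left_mono) auto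
    finally show ?thesis by simp
  qed
  moreover have "0 \<le> \<bar>f 0\<bar> + L * R" using L(1) R(1) by simp
  ultimately show thesis using that by blast
qed

lemma continuous_inverse_tendsto:
  assumes "derivative_has_continuous_inverse I" "(\<lambda>n. fderiv I (u n)) \<longlonglongrightarrow> A"
  shows "u \<longlonglongrightarrow> inv (fderiv I) A"
proof -
  have "(\<lambda>n. inv (fderiv I) (fderiv I (u n))) \<longlonglongrightarrow> inv (fderiv I) A"
    by (rule continuous_on_tendsto_compose[of UNIV "inv (fderiv I)"])
      (use assms in \<open>auto simp: derivative_has_continuous_inverse_def\<close>)
  moreover have "inj (fderiv I)"
    using assms(1) unfolding derivative_has_continuous_inverse_def bij_def by blast
  ultimately show ?thesis by (simp add: inv_f_f)
qed

lemma palais_smale_continuous_inverse: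
  assumes "derivative_has_continuous_inverse I"
  shows "palais_smale I"
  unfolding palais_smale_def
proof (intro allI impI)
  fix u assume "(\<lambda>n. fderiv I (u n)) \<longlonglongrightarrow> 0"
  from continuous_inverse_tendsto[OF assms this]
  have "(u \<circ> id) \<longlonglongrightarrow> inv (fderiv I) 0" by simp
  then show "\<exists>k l. strict_mono (k :: nat \<Rightarrow> nat) \<and> (u \<circ> k) \<longlonglongrightarrow> l"
    using strict_mono_id by blast
qed

text \<open>Along a Palais--Smale sequence the derivatives of \<open>K\<close> converge on a subsequence by compactness, hence so do
  those of \<open>I\<close>, and the continuous inverse carries this convergence back to the points.\<close>

lemma palais_smale_compact_perturbation:
  fixes I K :: "'a::real_normed_vector \<Rightarrow> real"
  assumes I: "C1 I" "derivative_has_continuous_inverse I"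
    and K: "C1 K" "compact_derivative K"
    and c: "c \<noteq> 0" and sub: "\<And>b. bounded {x. c * I x + K x \<le> b}"
  shows "palais_smale (\<lambda>x. c * I x + K x)"
  unfolding palais_smale_def
proof (intro allI impI)
  fix u
  let ?F = "\<lambda>x. c * I x + K x"
  assume vals: "bounded (range (\<lambda>n. ?F (u n)))" and lim: "(\<lambda>n. fderiv ?F (u n)) \<longlonglongrightarrow> 0"
  have F': "fderiv ?F x = c *\<^sub>R fderiv I x + fderiv K x" for x
    by (simp add: fderiv_add[OF C1_cmult[OF I(1)] K(1)] fderiv_cmult[OF I(1)])
  obtain b where "\<And>n. \<bar>?F (u n)\<bar> \<le> b" using vals unfolding bounded_iff by auto
  then have "?F (u n) \<le> b" for n by (meson abs_le_D1)
  then have "bounded (range u)" by (intro bounded_subset[OF sub[of b]]) auto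
  then have "compact (closure (fderiv K ` range u))"
    using K(2) unfolding compact_derivative_def by blast
  moreover have "\<forall>n. fderiv K (u n) \<in> closure (fderiv K ` range u)"
    by (intro allI subsetD[OF closure_subset] imageI rangeI)
  ultimately have "\<exists>A\<in>closure (fderiv K ` range u). \<exists>k. strict_mono (k :: nat \<Rightarrow> nat) \<and>
      ((\<lambda>n. fderiv K (u n)) \<circ> k) \<longlonglongrightarrow> A"
    unfolding compact_def by simp
  then obtain A k where k: "strict_mono (k :: nat \<Rightarrow> nat)" "((\<lambda>n. fderiv K (u n)) \<circ> k) \<longlonglongrightarrow> A"
    by blast
  have "(\<lambda>n. inverse c *\<^sub>R (fderiv ?F (u (k n)) - fderiv K (u (k n)))) \<longlonglongrightarrow> inverse c *\<^sub>R (0 - A)"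
    using LIMSEQ_subseq_LIMSEQ[OF lim k(1)] k(2) by (intro tendsto_intros) (simp_all add: o_def)
  then have "(\<lambda>n. fderiv I ((u \<circ> k) n)) \<longlonglongrightarrow> inverse c *\<^sub>R (0 - A)"
    using c by (simp add: F')
  from continuous_inverse_tendsto[OF I(2) this] k(1)
  show "\<exists>k l. strict_mono (k :: nat \<Rightarrow> nat) \<and> (u \<circ> k) \<longlonglongrightarrow> l" by blast
qed

text \<open>A second point not above \<open>a\<close> would give, by the mountain pass theorem, a critical point other than \<open>a\<close>; but
  the derivative is injective. This is what bounds \<open>I\<close> from below.\<close>

lemma strict_local_min_imp_strict_global_min:
  fixes I :: "'a::banach \<Rightarrow> real"
  assumes C1: "C1 I" and inv: "derivative_has_continuous_inverse I"
    and loc: "strict_local_min I a" and x: "x \<noteq> a"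
  shows "I a < I x"
proof (rule ccontr)
  assume "\<not> ?thesis"
  then have "I x \<le> I a" by simp
  then obtain w where w: "critical_point I w" "I a < I w"
    by (rule critical_point_above_strict_local_min
        [OF C1 palais_smale_continuous_inverse[OF inv] loc x])
  have "critical_point I a"
    using loc unfolding strict_local_min_def
    by (intro local_min_critical C1) (auto elim: eventually_mono)
  with w(1) have "fderiv I w = fderiv I a" by (simp add: critical_point_iff_fderiv[OF C1])
  then have "w = a"
    using inv unfolding derivative_has_continuous_inverse_def bij_def by (auto dest: injD)
  with w(2) show False by simp
qed

section \<open>Two minimizers at a common multiplier\<close>

text \<open>For small \<open>l\<close> the minimizers of \<open>P + l \<Phi>\<close> satisfy \<open>\<Phi> \<ge> r\<close>, because \<open>P\<close> is unbounded below; for large \<open>l\<close>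
  they satisfy \<open>\<Phi> \<le> r\<close>, because some point has \<open>\<Phi> < r\<close>. The multipliers having a minimizer of the one
  or of the other kind form two relatively closed sets that cover the half-line, so by connectedness
  they have a common member.\<close>

lemma two_minimizers_at_common_multiplier:
  fixes P \<Phi> :: "'a::metric_space \<Rightarrow> real"
  assumes P: "continuous_on UNIV P" and \<Phi>: "continuous_on UNIV \<Phi>"
    and attained: "\<And>l. 0 < l \<Longrightarrow> \<exists>x. global_min (\<lambda>x. P x + l * \<Phi> x) x"
    and compactness: "\<And>L u l. (\<And>n. 0 < L n) \<Longrightarrow> 0 < l \<Longrightarrow> L \<longlonglongrightarrow> l \<Longrightarrow>
      (\<And>n. global_min (\<lambda>x. P x + L n * \<Phi> x) (u n)) \<Longrightarrow>
      \<exists>k x. strict_mono (k :: nat \<Rightarrow> nat) \<and> (u \<circ> k) \<longlonglongrightarrow> x"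
    and unbounded: "\<And>c. \<exists>x. P x < c" and z: "\<Phi> z < r"
  obtains l u v where "0 < l" "global_min (\<lambda>x. P x + l * \<Phi> x) u" "global_min (\<lambda>x. P x + l * \<Phi> x) v"
    "\<Phi> u \<le> r" "r \<le> \<Phi> v"
proof -
  define m where "m l C \<longleftrightarrow> (\<exists>x. global_min (\<lambda>x. P x + l * \<Phi> x) x \<and> \<Phi> x \<in> C)" for l and C :: "real set"
  \<comment> \<open>A limit of minimizers is a minimizer for the limit multiplier.\<close>
  have m_lim: "m l C" if C: "closed C" and L: "\<And>n. 0 < L n" "0 < l" "L \<longlonglongrightarrow> l" "\<And>n. m (L n) C" for L l C
  proof -
    obtain u where u: "\<And>n. global_min (\<lambda>x. P x + L n * \<Phi> x) (u n)" "\<And>n. \<Phi> (u n) \<in> C"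
      using L(4) unfolding m_def by metis
    obtain k x where k: "strict_mono (k :: nat \<Rightarrow> nat)" "(u \<circ> k) \<longlonglongrightarrow> x"
      using compactness[OF L(1-3) u(1)] by blast
    have lim: "(\<lambda>n. P ((u \<circ> k) n)) \<longlonglongrightarrow> P x" "(\<lambda>n. \<Phi> ((u \<circ> k) n)) \<longlonglongrightarrow> \<Phi> x"
      by (rule continuous_on_tendsto_compose[OF P k(2)] continuous_on_tendsto_compose[OF \<Phi> k(2)]; simp)+
    have Lk: "(\<lambda>n. L (k n)) \<longlonglongrightarrow> l" using LIMSEQ_subseq_LIMSEQ[OF L(3) k(1)] by (simp add: o_def)
    have "P x + l * \<Phi> x \<le> P y + l * \<Phi> y" for y
    proof (rule LIMSEQ_le)
      show "(\<lambda>n. P ((u \<circ> k) n) + L (k n) * \<Phi> ((u \<circ> k) n)) \<longlonglongrightarrow> P x + l * \<Phi> x"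
        by (intro tendsto_intros lim Lk)
      show "(\<lambda>n. P y + L (k n) * \<Phi> y) \<longlonglongrightarrow> P y + l * \<Phi> y"
        by (intro tendsto_intros Lk)
    qed (use u(1) in \<open>auto simp: global_min_def\<close>)
    moreover have "\<Phi> x \<in> C" by (rule closed_sequentially[OF C _ lim(2)]) (simp add: u(2))
    ultimately show ?thesis unfolding m_def global_min_def by blast
  qed
  \<comment> \<open>The minimum at multiplier \<open>1\<close> serves as lower bound on both sides of \<open>1\<close>.\<close>
  obtain h where h: "\<And>y. h \<le> P y + \<Phi> y"
    using attained[of 1] unfolding global_min_def by auto
  obtain a where a: "0 < a" "m a {r..}"
  proof -
    obtain y where y: "P y < h - r - 1" using unbounded by blast
    \<comment> \<open>Chosen so that the value at \<open>y\<close> exceeds \<open>P y\<close> by at most \<open>1\<close>, after subtracting \<open>l * r\<close>.\<close>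
    define l where "l = inverse (1 + \<bar>\<Phi> y - r\<bar>)"
    have l: "0 < l" "l \<le> 1" "l * (\<Phi> y - r) \<le> 1"
      unfolding l_def by (auto simp: field_simps)
    obtain x where x: "global_min (\<lambda>x. P x + l * \<Phi> x) x" using attained l(1) by blast
    have "r \<le> \<Phi> x"
    proof (rule ccontr)
      assume "\<not> ?thesis"
      then have "(1 - l) * \<Phi> x \<le> (1 - l) * r" using l(2) by (intro mult_left_mono) auto
      moreover have "P x + l * \<Phi> x \<le> P y + l * \<Phi> y" using x unfolding global_min_def by blast
      ultimately show False using h[of x] y l(3) by (simp add: algebra_simps)
    qed
    with x l(1) that show thesis unfolding m_def by auto
  qed
  obtain b where b: "0 < b" "m b {..r}"
  proof -
    \<comment> \<open>At least \<open>1\<close>, and so large that \<open>P z + l * (\<Phi> z - r)\<close> falls below \<open>h - r\<close>.\<close>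
    define l where "l = 1 + (\<bar>P z - h + r\<bar> + 1) / (r - \<Phi> z)"
    have "l * (r - \<Phi> z) = (r - \<Phi> z) + (\<bar>P z - h + r\<bar> + 1)"
      unfolding l_def using z by (subst distrib_right) simp
    then have l: "1 \<le> l" "\<bar>P z - h + r\<bar> < l * (r - \<Phi> z)"
      unfolding l_def using z by auto
    obtain x where x: "global_min (\<lambda>x. P x + l * \<Phi> x) x" using attained[of l] l(1) by auto
    have "\<Phi> x \<le> r"
    proof (rule ccontr)
      assume "\<not> ?thesis"
      then have "(l - 1) * r \<le> (l - 1) * \<Phi> x" using l(1) by (intro mult_left_mono) auto
      moreover have "P x + l * \<Phi> x \<le> P z + l * \<Phi> z" using x unfolding global_min_def by blast
      ultimately show False using h[of x] l(2) by (simp add: algebra_simps)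
    qed
    moreover have "0 < l" using l(1) by simp
    ultimately show thesis using x that unfolding m_def by auto
  qed
  define T where "T = {min a b..max a b}"
  have T_pos: "0 < l" if "l \<in> T" for l using that a(1) b(1) unfolding T_def by auto
  have closed_T: "closed {l \<in> T. m l C}" if C: "closed C" for C
    unfolding closed_sequential_limits
  proof (intro allI impI, elim conjE)
    fix L l assume L: "\<forall>n. L n \<in> {l \<in> T. m l C}" "L \<longlonglongrightarrow> l"
    have "l \<in> T" by (rule closed_sequentially[of T L]) (use L in \<open>auto simp: T_def\<close>)
    then show "l \<in> {l \<in> T. m l C}" using m_lim[OF C _ T_pos L(2)] L(1) T_pos by blast
  qed
  have "\<exists>l\<in>T. m l {..r} \<and> m l {r..}"
  proof (rule ccontr)
    assume none: "\<not> ?thesis"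
    have cover: "T \<subseteq> {l \<in> T. m l {..r}} \<union> {l \<in> T. m l {r..}}"
    proof
      fix l assume "l \<in> T"
      then obtain x where "global_min (\<lambda>x. P x + l * \<Phi> x) x" using attained T_pos by blast
      then show "l \<in> {l \<in> T. m l {..r}} \<union> {l \<in> T. m l {r..}}"
        using \<open>l \<in> T\<close> linear[of "\<Phi> x" r] unfolding m_def by blast
    qed
    have "a \<in> T" "b \<in> T" unfolding T_def by auto
    then have "{l \<in> T. m l {..r}} \<inter> T \<noteq> {}" "{l \<in> T. m l {r..}} \<inter> T \<noteq> {}" using a b by auto
    moreover have "{l \<in> T. m l {..r}} \<inter> {l \<in> T. m l {r..}} \<inter> T = {}" using none by auto
    moreover have "connected T" unfolding T_def by simp
    ultimately show False
      using cover closed_T[of "{..r}"] closed_T[of "{r..}"] unfolding connected_closed by (meson closed_atLeast closed_atMost)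
  qed
  then show thesis using that T_pos unfolding m_def by auto
qed

text \<open>Minimizers for varying multipliers are almost critical for the limit multiplier: the derivatives differ
  by \<open>l - L n\<close> times a bounded quantity. So they form a Palais--Smale sequence.\<close>

lemma minimizers_subconverge:
  assumes P: "C1 P" and \<Phi>: "C1 \<Phi>" "compact_derivative \<Phi>"
    and ps: "palais_smale (\<lambda>x. P x + l * \<Phi> x)" and lower: "\<And>x. c \<le> P x + l * \<Phi> x"
    and L: "L \<longlonglongrightarrow> l" and u: "\<And>n. global_min (\<lambda>x. P x + L n * \<Phi> x) (u n)"
    and bounded: "bounded (range u)"
  shows "\<exists>k x. strict_mono (k :: nat \<Rightarrow> nat) \<and> (u \<circ> k) \<longlonglongrightarrow> x"
proof -
  have C1: "C1 (\<lambda>x. P x + t * \<Phi> x)" for t by (intro C1_add C1_cmult P \<Phi>)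
  have F': "fderiv (\<lambda>x. P x + t * \<Phi> x) x = fderiv P x + t *\<^sub>R fderiv \<Phi> x" for t x
    by (simp add: fderiv_add[OF P C1_cmult[OF \<Phi>(1)]] fderiv_cmult[OF \<Phi>(1)])
  obtain M where M: "0 \<le> M" "\<And>n. \<bar>\<Phi> (u n)\<bar> \<le> M"
    by (rule compact_derivative_bounded_on[OF \<Phi> bounded]) auto
  obtain N where N: "0 \<le> N" "\<And>n. norm (fderiv \<Phi> (u n)) \<le> N"
    by (rule compact_derivative_norm_bound[OF \<Phi>(2) bounded]) auto
  obtain B where B: "\<And>n. \<bar>L n\<bar> \<le> B"
    using convergent_imp_Bseq[of L] L unfolding convergent_def Bseq_def by auto
  have deriv: "fderiv (\<lambda>x. P x + l * \<Phi> x) (u n) = (l - L n) *\<^sub>R fderiv \<Phi> (u n)" for n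
  proof -
    have "fderiv (\<lambda>x. P x + L n * \<Phi> x) (u n) = 0"
      by (subst critical_point_iff_fderiv[OF C1, symmetric]) (rule global_min_critical[OF C1 u])
    then show ?thesis unfolding F' by (simp add: scaleR_left_diff_distrib add_eq_0_iff)
  qed
  have small: "norm (fderiv (\<lambda>x. P x + l * \<Phi> x) (u n)) \<le> \<bar>l - L n\<bar> * N" for n
    unfolding deriv using N by (simp add: mult_left_mono)
  have "(\<lambda>n. \<bar>l - L n\<bar> * N) \<longlonglongrightarrow> \<bar>l - l\<bar> * N" by (intro tendsto_intros L)
  then have null: "(\<lambda>n. \<bar>l - L n\<bar> * N) \<longlonglongrightarrow> 0" by simp
  have upper: "P (u n) + l * \<Phi> (u n) \<le> P (u 0) + B * M + (\<bar>l\<bar> + B) * M" for n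
  proof -
    have "P (u n) + L n * \<Phi> (u n) \<le> P (u 0) + L n * \<Phi> (u 0)"
      using u[of n] unfolding global_min_def by blast
    moreover have "\<bar>L n * \<Phi> (u 0)\<bar> \<le> B * M"
      unfolding abs_mult using B[of n] M by (intro mult_mono) auto
    moreover have "\<bar>(l - L n) * \<Phi> (u n)\<bar> \<le> (\<bar>l\<bar> + B) * M"
      unfolding abs_mult using B[of n] M by (intro mult_mono) auto
    ultimately show ?thesis by (simp add: left_diff_distrib)
  qed
  show ?thesis
  proof (rule palais_smaleE[OF ps C1, where u = u, OF lower upper small null])
    show ?thesis if "strict_mono k" "(u \<circ> k) \<longlonglongrightarrow> x" for k :: "nat \<Rightarrow> nat" and x
      using that by blast
  qed
qed

text \<open>On the level set \<open>\<Phi> = r\<close> one has \<open>\<Psi> \<ge> \<gamma> - r\<close> and \<open>\<Gamma> \<ge> \<eta>\<close>, so that \<open>\<mu> \<Gamma> + \<Psi> \<ge> \<mu> \<eta> + \<gamma> - r\<close>. A point \<open>z\<close> whose quotient in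
  the definition of \<open>\<mu>\<^sup>*\<close> is below \<open>\<mu>\<close> is exactly one at which \<open>\<mu> \<Gamma> + \<Psi>\<close> is below that bound. If the level set
  is empty, then \<open>\<eta> = \<infinity>\<close> and the second claim is vacuous.\<close>

lemma mu_star_strict_separation:
  assumes less: "mu_star \<Gamma> \<Psi> \<Phi> r < ereal \<mu>" and \<mu>: "0 < \<mu>"
    and lower: "\<And>x. c \<le> \<Psi> x + \<Phi> x"
  obtains z where "\<Phi> z < r" "\<And>y. \<Phi> y = r \<Longrightarrow> \<mu> * \<Gamma> z + \<Psi> z < \<mu> * \<Gamma> y + \<Psi> y"
proof -
  define \<gamma> where "\<gamma> = (INF y. ereal (\<Psi> y + \<Phi> y))"
  obtain z where z: "\<Phi> z < r" "ereal (\<Gamma> z) < eta \<Gamma> \<Phi> r"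
    and quot: "(ereal (\<Psi> z) - \<gamma> + ereal r) / (eta \<Gamma> \<Phi> r - ereal (\<Gamma> z)) < ereal \<mu>"
    using less unfolding mu_star_def \<gamma>_def INF_less_iff by auto
  have \<gamma>_le: "\<gamma> \<le> ereal (\<Psi> y + \<Phi> y)" for y unfolding \<gamma>_def by (rule INF_lower) simp
  have "ereal c \<le> \<gamma>" unfolding \<gamma>_def by (rule INF_greatest) (use lower in simp)
  with \<gamma>_le[of z] obtain g where g: "\<gamma> = ereal g" by (cases \<gamma>) auto
  have "\<mu> * \<Gamma> z + \<Psi> z < \<mu> * \<Gamma> y + \<Psi> y" if y: "\<Phi> y = r" for y
  proof -
    have \<eta>_le: "eta \<Gamma> \<Phi> r \<le> ereal (\<Gamma> y)" unfolding eta_def by (rule INF_lower) (use y in simp)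
    with z(2) obtain e where e: "eta \<Gamma> \<Phi> r = ereal e" by (cases "eta \<Gamma> \<Phi> r") auto
    have ez: "\<Gamma> z < e" using z(2) e by simp
    then have "(\<Psi> z - g + r) / (e - \<Gamma> z) < \<mu>" using quot unfolding e g by simp
    then have "\<Psi> z - g + r < \<mu> * (e - \<Gamma> z)" using ez by (simp add: field_simps)
    moreover have "\<mu> * e \<le> \<mu> * \<Gamma> y" using \<eta>_le \<mu> unfolding e by simp
    moreover have "g \<le> \<Psi> y + r" using \<gamma>_le[of y] y unfolding g by simp
    ultimately show ?thesis by (simp add: right_diff_distrib)
  qed
  with z(1) that show thesis by blast
qed

section \<open>Growth of the functionals at infinity and at the local minimum\<close>

lemma coercive_bounded_sublevel:
  assumes "coercive f"
  shows "bounded {x. f x \<le> c}"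
proof -
  have "\<forall>\<^sub>F x in at_infinity. c < f x"
    using assms unfolding coercive_def filterlim_at_top_dense by blast
  then obtain b where b: "\<And>x. b \<le> norm x \<Longrightarrow> c < f x"
    unfolding eventually_at_infinity by blast
  have "{x. f x \<le> c} \<subseteq> cball 0 b"
  proof
    fix x assume "x \<in> {x. f x \<le> c}"
    then show "x \<in> cball 0 b" using b[of x] by (cases "b \<le> norm x") auto
  qed
  then show ?thesis using bounded_cball bounded_subset by blast
qed

lemma coercive_add_multiple:
  assumes I: "coercive I" and \<nu>: "0 < \<nu>"
    and J: "Liminf at_infinity (\<lambda>x. ereal (J x / I x)) \<ge> 0"
  shows "coercive (\<lambda>x. I x + \<nu> * J x)"
proof -
  have "ereal (- (1 / (2 * \<nu>))) < Liminf at_infinity (\<lambda>x. ereal (J x / I x))"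
    by (rule less_le_trans[OF _ J]) (use \<nu> in simp)
  from less_LiminfD[OF this] have "\<forall>\<^sub>F x in at_infinity. - (1 / (2 * \<nu>)) < J x / I x"
    by simp
  moreover have "\<forall>\<^sub>F x in at_infinity. 0 < I x"
    using I unfolding coercive_def filterlim_at_top_dense by blast
  ultimately have "\<forall>\<^sub>F x in at_infinity. I x * (1 / 2) \<le> I x + \<nu> * J x"
  proof eventually_elim
    case (elim x)
    then show ?case using \<nu> by (simp add: field_simps)
  qed
  moreover have "filterlim (\<lambda>x. I x * (1 / 2)) at_top at_infinity"
    using I unfolding coercive_def by (intro filterlim_at_top_mult_tendsto_pos[OF tendsto_const]) auto
  ultimately show ?thesis
    unfolding coercive_def by (rule filterlim_at_top_mono[rotated])
qed

text \<open>Where the sum is positive there is nothing to bound; the rest is a bounded set, on which \<open>J\<close> is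
  bounded and \<open>I\<close> nonnegative.\<close>

lemma coercive_bounded_below:
  assumes co: "coercive (\<lambda>x. I x + \<nu> * J x)" and I: "\<And>x. 0 \<le> I x" and \<nu>: "0 < \<nu>"
    and J: "C1 J" "compact_derivative J"
  obtains c where "\<And>x. c \<le> I x + \<nu> * J x"
proof -
  obtain L where L: "0 \<le> L" "\<And>x. x \<in> {x. I x + \<nu> * J x \<le> 0} \<Longrightarrow> \<bar>J x\<bar> \<le> L"
    by (rule compact_derivative_bounded_on[OF J coercive_bounded_sublevel[OF co]]) blast
  have "- (\<nu> * L) \<le> I x + \<nu> * J x" for x
  proof (cases "I x + \<nu> * J x \<le> 0")
    case True
    then have "- L \<le> J x" using L(2)[of x] by auto
    then have "\<nu> * (- L) \<le> \<nu> * J x" using \<nu> by (intro mult_left_mono) auto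
    then show ?thesis using I[of x] by simp
  next
    case False
    then show ?thesis using L(1) \<nu> by (smt (verit) mult_nonneg_nonneg)
  qed
  with that show thesis by blast
qed

text \<open>Far out, \<open>J\<close> is at most a multiple of \<open>I\<close>, while \<open>\<Psi>\<close> somewhere falls below any prescribed negative multiple
  of \<open>I\<close>.\<close>

lemma unbounded_below_at_infinity:
  assumes I: "coercive I" and \<mu>: "0 < \<mu>" and \<nu>: "0 < \<nu>"
    and J: "Limsup at_infinity (\<lambda>x. ereal (J x / I x)) < \<infinity>"
    and \<Psi>: "Liminf at_infinity (\<lambda>x. ereal (\<Psi> x / I x)) = - \<infinity>"
  shows "\<exists>x. \<mu> * (I x + \<nu> * J x) + \<Psi> x < c"
proof -
  obtain k where "Limsup at_infinity (\<lambda>x. ereal (J x / I x)) < ereal k"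
    using J less_PInf_Ex_of_nat by (metis ereal_dense2)
  from Limsup_lessD[OF this] have J_le: "\<forall>\<^sub>F x in at_infinity. J x / I x < k"
    by simp
  have I_ge: "\<forall>\<^sub>F x in at_infinity. 1 < I x"
    using I unfolding coercive_def filterlim_at_top_dense by blast
  \<comment> \<open>The first summand absorbs \<open>\<mu> * (I + \<nu> * J)\<close>; the second beats \<open>c\<close>, as \<open>I > 1\<close> at the chosen point.\<close>
  define M where "M = \<mu> * (1 + \<nu> * k) + \<bar>c\<bar>"
  have "\<not> (\<forall>\<^sub>F x in at_infinity. ereal (- M) \<le> ereal (\<Psi> x / I x))"
    using Liminf_bounded[of "ereal (- M)" "\<lambda>x. ereal (\<Psi> x / I x)" at_infinity] \<Psi> by auto
  then have "\<exists>\<^sub>F x in at_infinity. \<Psi> x / I x < - M"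
    unfolding frequently_def by (simp add: not_less)
  then have "\<exists>\<^sub>F x in at_infinity. \<Psi> x / I x < - M \<and> J x / I x < k \<and> 1 < I x"
    using J_le I_ge by (auto intro: frequently_eventually_frequently eventually_conj)
  then obtain x where x: "\<Psi> x / I x < - M" "J x / I x < k" "1 < I x"
    using frequently_ex by blast
  have "J x < k * I x" "\<Psi> x < - M * I x" using x by (simp_all add: pos_divide_less_eq)
  then have "\<mu> * \<nu> * J x \<le> \<mu> * \<nu> * (k * I x)" using \<mu> \<nu> by (intro mult_left_mono) auto
  then have "\<mu> * (I x + \<nu> * J x) + \<Psi> x < - \<bar>c\<bar> * I x"
    using \<open>\<Psi> x < - M * I x\<close> unfolding M_def by (simp add: algebra_simps)
  also have "\<dots> \<le> - \<bar>c\<bar>" using x(3) mult_left_mono[of 1 "I x" "\<bar>c\<bar>"] by simp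
  also have "\<dots> \<le> c" by simp
  finally show ?thesis by blast
qed

text \<open>Dividing by \<open>I > 0\<close> near \<open>a\<close>, the quotients of \<open>J\<close> and \<open>\<Phi>\<close> are almost nonnegative and that of \<open>\<Psi>\<close> exceeds \<open>- \<mu>\<close>
  by a fixed amount, so the combination is at least a positive multiple of \<open>I\<close>.\<close>

lemma strict_local_min_combination:
  assumes I: "strict_local_min I a" and zero: "I a = 0" "J a = 0" "\<Psi> a = 0" "\<Phi> a = 0"
    and \<nu>: "0 < \<nu>" and \<mu>: "0 < \<mu>" and l: "0 < l"
    and J: "0 \<le> Liminf (at a) (\<lambda>x. ereal (J x / I x))"
    and \<Phi>: "0 \<le> Liminf (at a) (\<lambda>x. ereal (\<Phi> x / I x))"
    and \<Psi>: "- ereal \<mu> < Liminf (at a) (\<lambda>x. ereal (\<Psi> x / I x))"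
  shows "strict_local_min (\<lambda>x. \<mu> * (I x + \<nu> * J x) + \<Psi> x + l * \<Phi> x) a"
proof -
  obtain q where q: "- \<mu> < q" "ereal q < Liminf (at a) (\<lambda>x. ereal (\<Psi> x / I x))"
    using ereal_dense2[OF \<Psi>] by auto
  \<comment> \<open>The lower bounds \<open>- d\<close> for the quotients of \<open>J\<close> and \<open>\<Phi>\<close> cost half of the surplus \<open>\<mu> + q\<close>.\<close>
  define d where "d = (\<mu> + q) / (2 * (\<mu> * \<nu> + l))"
  have pos: "0 < \<mu> * \<nu> + l" using \<mu> \<nu> l by (simp add: add_pos_pos)
  have d: "0 < d" "d * (\<mu> * \<nu> + l) = (\<mu> + q) / 2"
  proof -
    show "0 < d" unfolding d_def using q(1) pos by (intro divide_pos_pos) auto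
    have "m / (2 * D) * D = m / 2" if "0 < D" for m D :: real using that by simp
    from this[OF pos] show "d * (\<mu> * \<nu> + l) = (\<mu> + q) / 2" unfolding d_def .
  qed
  have quot: "\<forall>\<^sub>F x in at a. - d < f x / I x"
    if "0 \<le> Liminf (at a) (\<lambda>x. ereal (f x / I x))" for f
  proof -
    have "ereal (- d) < Liminf (at a) (\<lambda>x. ereal (f x / I x))"
      by (rule less_le_trans[OF _ that]) (use d(1) in simp)
    from less_LiminfD[OF this] show ?thesis by simp
  qed
  have "\<forall>\<^sub>F x in at a. q < \<Psi> x / I x" using less_LiminfD[OF q(2)] by simp
  moreover have "\<forall>\<^sub>F x in at a. 0 < I x" using I zero(1) unfolding strict_local_min_def by simp
  ultimately have "\<forall>\<^sub>F x in at a. 0 < \<mu> * (I x + \<nu> * J x) + \<Psi> x + l * \<Phi> x"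
    using quot[OF J] quot[OF \<Phi>]
  proof eventually_elim
    case (elim x)
    then have "- d * I x < J x" "- d * I x < \<Phi> x" and q_less: "q * I x < \<Psi> x"
      by (simp_all add: pos_less_divide_eq)
    then have "\<mu> * \<nu> * (- d * I x) \<le> \<mu> * \<nu> * J x" "l * (- d * I x) \<le> l * \<Phi> x"
      by (intro mult_left_mono less_imp_le mult_pos_pos \<mu> \<nu> l; simp)+
    with q_less have "\<mu> * I x + q * I x - d * (\<mu> * \<nu> + l) * I x < \<mu> * (I x + \<nu> * J x) + \<Psi> x + l * \<Phi> x"
      by (simp add: algebra_simps)
    moreover have "0 < (\<mu> + q) / 2 * I x" using q(1) elim by simp
    moreover have "\<mu> * I x + q * I x - d * (\<mu> * \<nu> + l) * I x = (\<mu> + q) / 2 * I x"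
      unfolding d(2) by (simp add: field_simps)
    ultimately show ?case by linarith
  qed
  then show ?thesis unfolding strict_local_min_def using zero by simp
qed

lemma INF_ereal_bounded_below:
  fixes f :: "'a \<Rightarrow> real"
  assumes "(INF x. ereal (f x)) > - \<infinity>"
  obtains c where "\<And>x. c \<le> f x"
proof -
  obtain c where "ereal c < (INF x. ereal (f x))" using ereal_dense2[OF assms] by blast
  then have "c \<le> f x" for x using less_INF_D[of "ereal c" "\<lambda>x. ereal (f x)" UNIV x] by simp
  with that show thesis by blast
qed

section \<open>Four critical points\<close>

theorem theorem1:
  fixes I J \<Psi> \<Phi> :: "'a::banach \<Rightarrow> real" and x0 x1 :: 'a and \<nu> \<mu> :: real
  assumes "reflexive_space TYPE('a)"
    and "C1 I" and "seq_weakly_lsc I" and "coercive I"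
    and "derivative_has_continuous_inverse I"
    and "C1 J" and "compact_derivative J"
    and "C1 \<Psi>" and "compact_derivative \<Psi>"
    and "C1 \<Phi>" and "compact_derivative \<Phi>"
    and "Liminf at_infinity (\<lambda>x. ereal (J x / I x)) \<ge> 0"
    and "Limsup at_infinity (\<lambda>x. ereal (J x / I x)) < \<infinity>"
    and "Liminf at_infinity (\<lambda>x. ereal (\<Psi> x / I x)) = - \<infinity>"
    and "\<And>l::real. l > 0 \<Longrightarrow> (INF x. ereal (\<Psi> x + l * \<Phi> x)) > - \<infinity>"
    and "strict_local_min I x0"
    and "I x0 = 0" and "J x0 = 0" and "\<Psi> x0 = 0" and "\<Phi> x0 = 0"
    and "max (J x1) (max (\<Psi> x1) (\<Phi> x1)) < 0"
    and "min (Liminf (at x0) (\<lambda>x. ereal (J x / I x)))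
             (Liminf (at x0) (\<lambda>x. ereal (\<Phi> x / I x))) \<ge> 0"
    and "Liminf (at x0) (\<lambda>x. ereal (\<Psi> x / I x)) > - \<infinity>"
    and "\<nu> > max 0 (- (I x1 / J x1))"
    and "ereal \<mu> > max 0 (max (- Liminf (at x0) (\<lambda>x. ereal (\<Psi> x / I x)))
           (INF r\<in>{r. mu_star_defined (\<lambda>x. I x + \<nu> * J x) \<Phi> r \<and>
                      ereal r > (SUP x\<in>{x. global_min (\<lambda>x. I x + \<nu> * J x) x}. ereal (\<Phi> x))}.
              mu_star (\<lambda>x. I x + \<nu> * J x) \<Psi> \<Phi> r))"
  shows "\<exists>ls>0. let F = (\<lambda>x. \<mu> * (I x + \<nu> * J x) + \<Psi> x + ls * \<Phi> x) in
           \<exists>u v w. distinct [x0, u, v, w] \<and>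
             critical_point F x0 \<and> critical_point F u \<and> critical_point F v \<and> critical_point F w \<and>
             strict_local_min F x0 \<and> \<not> global_min F x0 \<and>
             global_min F u \<and> global_min F v"
proof -
  note I = assms(2) assms(5) and J = assms(6,7) and \<Psi> = assms(8,9) and \<Phi> = assms(10,11)
  have \<nu>: "0 < \<nu>" "- (I x1 / J x1) < \<nu>" using assms(24) by simp_all
  define \<Gamma> where "\<Gamma> x = I x + \<nu> * J x" for x
  define P where "P x = \<mu> * (I x + \<nu> * J x) + \<Psi> x" for x
  have \<mu>: "0 < \<mu>" and \<mu>_\<Psi>: "- Liminf (at x0) (\<lambda>x. ereal (\<Psi> x / I x)) < ereal \<mu>"
    using assms(25) by simp_all
  obtain r where mu_star: "mu_star \<Gamma> \<Psi> \<Phi> r < ereal \<mu>"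
    using assms(25) unfolding \<Gamma>_def by (auto simp: INF_less_iff)
  have lower: "\<exists>c. \<forall>x. c \<le> \<Psi> x + l * \<Phi> x" if "0 < l" for l
    using assms(15)[OF that] by (rule INF_ereal_bounded_below) blast
  obtain z where z: "\<Phi> z < r" "\<And>y. \<Phi> y = r \<Longrightarrow> P z < P y"
  proof -
    obtain c where "\<And>x. c \<le> \<Psi> x + \<Phi> x" using lower[of 1] by auto
    from mu_star_strict_separation[OF mu_star \<mu> this]
    obtain z where "\<Phi> z < r" "\<And>y. \<Phi> y = r \<Longrightarrow> \<mu> * \<Gamma> z + \<Psi> z < \<mu> * \<Gamma> y + \<Psi> y"
      by blast
    then show thesis by (intro that[of z]) (simp_all add: P_def \<Gamma>_def)
  qed
  have I_nonneg: "0 \<le> I x" for x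
    using strict_local_min_imp_strict_global_min[OF I assms(16), of x] assms(17)
    by (cases "x = x0") auto
  have \<Gamma>_coercive: "coercive \<Gamma>"
    using coercive_add_multiple[OF assms(4) \<nu>(1) assms(12)] unfolding \<Gamma>_def .
  obtain c\<Gamma> where c\<Gamma>: "\<And>x. c\<Gamma> \<le> \<Gamma> x"
    using \<Gamma>_coercive unfolding \<Gamma>_def
    by (rule coercive_bounded_below[OF _ I_nonneg \<nu>(1) J]) blast
  have C1_P: "C1 P"
    unfolding P_def by (intro C1_add C1_cmult I J \<Psi>)
  have C1_F: "C1 (\<lambda>x. P x + l * \<Phi> x)" for l by (intro C1_add C1_cmult C1_P \<Phi>)
  have F_sublevel: "\<exists>B. bounded B \<and> (\<forall>l\<in>{a..b}. \<forall>x. P x + l * \<Phi> x \<le> t \<longrightarrow> x \<in> B)"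
    if ab: "0 < a" "a \<le> b" for a b t
  proof -
    obtain c where c: "\<And>x. c \<le> \<Psi> x + a * \<Phi> x" using lower[OF ab(1)] by blast
    obtain c' where c': "\<And>x. c' \<le> \<Psi> x + b * \<Phi> x" using lower[of b] ab by auto
    have "\<Gamma> x \<le> (t - min c c') / \<mu>" if l: "l \<in> {a..b}" and x: "P x + l * \<Phi> x \<le> t" for l x
    proof -
      \<comment> \<open>In \<open>l\<close> the sum is affine, so its minimum over \<open>[a, b]\<close> is at an end point.\<close>
      have "min c c' \<le> \<Psi> x + l * \<Phi> x"
      proof (cases "0 \<le> \<Phi> x")
        case True
        then have "a * \<Phi> x \<le> l * \<Phi> x" using l by (intro mult_right_mono) auto
        then show ?thesis using c[of x] by simp
      next
        case False
        then have "b * \<Phi> x \<le> l * \<Phi> x" using l by (intro mult_right_mono_neg) auto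
        then show ?thesis using c'[of x] by simp
      qed
      then have "\<Gamma> x * \<mu> \<le> t - min c c'" using x unfolding P_def \<Gamma>_def by (simp add: mult.commute)
      then show ?thesis using \<mu> by (simp add: pos_le_divide_eq)
    qed
    then show ?thesis using coercive_bounded_sublevel[OF \<Gamma>_coercive] by (metis mem_Collect_eq)
  qed
  have F_lower: "\<exists>c. \<forall>x. c \<le> P x + l * \<Phi> x" if l: "0 < l" for l
  proof -
    obtain c where c: "\<And>x. c \<le> \<Psi> x + l * \<Phi> x" using lower[OF l] by blast
    have "\<mu> * c\<Gamma> + c \<le> P x + l * \<Phi> x" for x
    proof -
      have "\<mu> * c\<Gamma> \<le> \<mu> * \<Gamma> x" using \<mu> by (intro mult_left_mono c\<Gamma>) simp
      then show ?thesis using c[of x] unfolding P_def \<Gamma>_def by linarith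
    qed
    then show ?thesis by blast
  qed
  have F_ps: "palais_smale (\<lambda>x. P x + l * \<Phi> x)" if l: "0 < l" for l
  proof -
    define K where "K x = \<mu> * \<nu> * J x + (\<Psi> x + l * \<Phi> x)" for x
    have F_K: "(\<lambda>x. P x + l * \<Phi> x) = (\<lambda>x. \<mu> * I x + K x)"
      unfolding P_def K_def by (auto simp: algebra_simps)
    have "C1 K" unfolding K_def by (intro C1_add C1_cmult J \<Psi> \<Phi>)
    moreover have "compact_derivative K"
      unfolding K_def by (intro compact_derivative_add compact_derivative_cmult C1_add C1_cmult J \<Psi> \<Phi>)
    moreover have "bounded {x. \<mu> * I x + K x \<le> t}" for t
    proof -
      obtain B where "bounded B" "\<forall>x. P x + l * \<Phi> x \<le> t \<longrightarrow> x \<in> B"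
        using F_sublevel[OF l order_refl, of t] by auto
      then show ?thesis
        using fun_cong[OF F_K] by (auto intro: bounded_subset)
    qed
    ultimately show ?thesis
      unfolding F_K using \<mu> by (intro palais_smale_compact_perturbation I) auto
  qed
  have F_min: "\<exists>x. global_min (\<lambda>x. P x + l * \<Phi> x) x" if "0 < l" for l
    using palais_smale_global_min[OF C1_F F_ps[OF that]] F_lower[OF that] by blast
  \<comment> \<open>For multipliers near \<open>l\<close> all minimizers lie in one bounded sublevel set, since \<open>x0\<close> gives the value \<open>0\<close>.\<close>
  have F_compact: "\<exists>k x. strict_mono (k :: nat \<Rightarrow> nat) \<and> (u \<circ> k) \<longlonglongrightarrow> x"
    if L: "\<And>n. 0 < L n" "0 < l" "L \<longlonglongrightarrow> l" and u: "\<And>n. global_min (\<lambda>x. P x + L n * \<Phi> x) (u n)"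
    for L u l
  proof -
    have "\<forall>\<^sub>F n in sequentially. l / 2 < L n \<and> L n < 2 * l"
      using L(2,3) by (intro eventually_conj order_tendstoD[OF L(3)]) auto
    then obtain N where N: "\<And>n. l / 2 < L (n + N)" "\<And>n. L (n + N) < 2 * l"
      unfolding eventually_sequentially by (metis le_add2)
    obtain B where B: "bounded B" "\<And>t x. t \<in> {l / 2..2 * l} \<Longrightarrow> P x + t * \<Phi> x \<le> 0 \<Longrightarrow> x \<in> B"
      using F_sublevel[of "l / 2" "2 * l" 0] L(2) by auto
    have "u (n + N) \<in> B" for n
    proof (rule B(2)[of "L (n + N)"])
      show "L (n + N) \<in> {l / 2..2 * l}" using N[of n] by simp
      have "P (u (n + N)) + L (n + N) * \<Phi> (u (n + N)) \<le> P x0 + L (n + N) * \<Phi> x0"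
        using u unfolding global_min_def by blast
      then show "P (u (n + N)) + L (n + N) * \<Phi> (u (n + N)) \<le> 0"
        using assms(17-20) unfolding P_def by simp
    qed
    then have "range (\<lambda>n. u (n + N)) \<subseteq> B" by (rule image_subsetI)
    then have bdd: "bounded (range (\<lambda>n. u (n + N)))" by (rule bounded_subset[OF B(1)])
    obtain c where c: "\<And>x. c \<le> P x + l * \<Phi> x" using F_lower[OF L(2)] by blast
    have "\<exists>k x. strict_mono (k :: nat \<Rightarrow> nat) \<and> ((\<lambda>n. u (n + N)) \<circ> k) \<longlonglongrightarrow> x"
      by (rule minimizers_subconverge[OF C1_P \<Phi> F_ps[OF L(2)] c
          LIMSEQ_ignore_initial_segment[OF L(3), of N] u bdd])
    then obtain k x where k: "strict_mono (k :: nat \<Rightarrow> nat)" "((\<lambda>n. u (n + N)) \<circ> k) \<longlonglongrightarrow> x"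
      by blast
    have "strict_mono (\<lambda>n. k n + N)" using k(1) by (simp add: strict_mono_def)
    moreover have "(u \<circ> (\<lambda>n. k n + N)) \<longlonglongrightarrow> x" using k(2) by (simp add: o_def)
    ultimately show ?thesis by blast
  qed
  obtain l u v where l: "0 < l" and u: "global_min (\<lambda>x. P x + l * \<Phi> x) u" "\<Phi> u \<le> r"
    and v: "global_min (\<lambda>x. P x + l * \<Phi> x) v" "r \<le> \<Phi> v"
  proof (rule two_minimizers_at_common_multiplier[of P \<Phi> z r])
    show "continuous_on UNIV P" "continuous_on UNIV \<Phi>" by (intro C1_continuous_on C1_P \<Phi>)+
    show "\<exists>x. P x < c" for c
      unfolding P_def by (rule unbounded_below_at_infinity[OF assms(4) \<mu> \<nu>(1) assms(13,14)])
  qed (use F_min F_compact z(1) in blast)+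
  \<comment> \<open>On the level \<open>r\<close> of \<open>\<Phi>\<close> the functional exceeds its value at \<open>z\<close>.\<close>
  have off_level: "\<Phi> y \<noteq> r" if "global_min (\<lambda>x. P x + l * \<Phi> x) y" for y
  proof
    assume y: "\<Phi> y = r"
    have "P y + l * \<Phi> y \<le> P z + l * \<Phi> z" using that unfolding global_min_def by blast
    moreover have "l * \<Phi> z < l * \<Phi> y" using z(1) l y by simp
    ultimately show False using z(2)[OF y] by linarith
  qed
  then have uv: "u \<noteq> v" using u v by force
  define F where "F x = P x + l * \<Phi> x" for x
  have C1: "C1 F" and ps: "palais_smale F" using C1_F F_ps[OF l] unfolding F_def by auto
  have gm: "global_min F u" "global_min F v" using u(1) v(1) unfolding F_def .
  have F0: "F x0 = 0" using assms(17-20) unfolding F_def P_def by simp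
  have "F x1 < 0"
  proof -
    have neg: "J x1 < 0" "\<Psi> x1 < 0" "\<Phi> x1 < 0" using assms(21) by auto
    then have "I x1 + \<nu> * J x1 < 0" using \<nu>(2) by (simp add: field_simps)
    then have "\<mu> * (I x1 + \<nu> * J x1) < 0" using \<mu> by (simp add: mult_pos_neg)
    moreover have "l * \<Phi> x1 < 0" using l neg(3) by (simp add: mult_pos_neg)
    ultimately show ?thesis using neg(2) unfolding F_def P_def by simp
  qed
  then have neg: "F u < 0" "F v < 0" using gm unfolding global_min_def by (meson le_less_trans)+
  have loc: "strict_local_min F x0"
    unfolding F_def P_def
  proof (rule strict_local_min_combination[where I = I and J = J and \<Psi> = \<Psi> and \<Phi> = \<Phi>,
        OF assms(16-20) \<nu>(1) \<mu> l])
    show "- ereal \<mu> < Liminf (at x0) (\<lambda>x. ereal (\<Psi> x / I x))"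
      using \<mu>_\<Psi> by (simp add: ereal_uminus_less_reorder)
  qed (use assms(22) in auto)
  \<comment> \<open>The mountain pass between \<open>x0\<close> and \<open>u\<close> has positive height, which tells \<open>w\<close> from the other three points.\<close>
  have "u \<noteq> x0" "F u \<le> F x0" using neg F0 by auto
  then obtain w where w: "critical_point F w" "F x0 < F w"
    by (rule critical_point_above_strict_local_min[OF C1 ps loc])
  have "critical_point F x0"
    using loc unfolding strict_local_min_def
    by (intro local_min_critical C1) (auto elim: eventually_mono)
  moreover have "critical_point F u" "critical_point F v" using global_min_critical[OF C1] gm by auto
  moreover have "distinct [x0, u, v, w]" using neg F0 w(2) uv by auto
  moreover have "\<not> global_min F x0" using neg(1) F0 unfolding global_min_def by (auto simp: not_le)
  ultimately have "\<exists>u v w. distinct [x0, u, v, w] \<and>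
      critical_point F x0 \<and> critical_point F u \<and> critical_point F v \<and> critical_point F w \<and>
      strict_local_min F x0 \<and> \<not> global_min F x0 \<and> global_min F u \<and> global_min F v"
    using w(1) loc gm by blast
  then show ?thesis
    using l unfolding F_def P_def Let_def by blast
qed

end
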